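(* Let $q=(c_1,\xi_1,c_2,\xi_2)\in\mathbb{R}^{6}$ with $c_1,c_2\in\mathbb{R}^2$, $\xi_1,\xi_2\in\mathbb{R}$, and consider the convex optimization problem $$\Phi(q)=\min_{p,\alpha,y_1,y_2}\ \alpha-1\quad\text{s.t.}\quad A_1R(\xi_1)^\top(y_1-c_1)\le \alpha b_1-\mathbf{1}r,\quad A_2R(\xi_2)^\top(y_2-c_2)\le \alpha b_2-\mathbf{1}r,$$ $$(p-y_1)^\top(p-y_1)\le r^2,\quad (p-y_2)^\top(p-y_2)\le r^2,$$ in the variables $z=(p,\alpha,y_1,y_2)\in\mathbb{R}^2\times\mathbb{R}\times\mathbb{R}^2\times\mathbb{R}^2$. Then: (i) For every $q$ with $c_1\neq c_2$, the optimal dual variables (Lagrange multipliers) $\mu=(\mu_{1,\mathrm p},\mu_{2,\mathrm p},\mu_{1,\mathrm c},\mu_{2,\mathrm c})$ of this problem are unique, and they depend continuously on $q$ (on the set of $q$ with $c_1\ne c_2$). (ii) For every $q$ with $c_1\neq c_2$ such that there is no patch contact between the scaled padded polytopes, the optimal primal variables $z=(p,\alpha,y_1,y_2)$ are unique.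
   Context: Setting. For $i=1,2$, $\mathcal{P}_i=\{x\in\mathbb{R}^2: A_ix\le b_i\}$ is a (bounded) planar polytope, with $A_i\in\mathbb{R}^{n_{i,\mathrm h}\times 2}$ and $b_i\in\mathbb{R}^{n_{i,\mathrm h}}$. The rows of $A_i$ have Euclidean norm one. The scalar $r>0$ satisfies $b_i-\mathbf{1}r>0$ componentwise, where $\mathbf 1$ is the all-ones vector. The polytopes are assumed non-degenerate: two distinct halfspace constraints of the same body that are active at an optimal point with positive multipliers have linearly independent normals, i.e. the $2\times2$ matrix formed by the two corresponding rows of $A_i$ is invertible. $R(\theta)=\begin{pmatrix}\cos\theta&-\sin\theta\\ \sin\theta&\cos\theta\end{pmatrix}$. Scaled padded polytopes: for $\alpha>0$, $\mathcal{B}_i(q,\alpha)=\{p\in\mathbb{R}^2:\ \exists\,y_i\in\mathbb{R}^2,\ A_iR(\xi_i)^\top(y_i-c_i)\le\alpha b_i-\mathbf 1 r,\ \|p-y_i\|_2\le r\}$. With $\alpha^*=\Phi(q)+1$ the optimal scaling factor, there is a patch contact between the scaled padded polytopes if there are multiple distinct points that lie simultaneously in the surfaces of both $\mathcal{B}_1(q,\alpha^* )$ and $\mathcal{B}_2(q,\alpha^* )$. Dual variables: $\mu_{1,\mathrm p}\in\mathbb{R}^{n_{1,\mathrm h}}_{\ge0}$, $\mu_{2,\mathrm p}\in\mathbb{R}^{n_{2,\mathrm h}}_{\ge0}$, $\mu_{1,\mathrm c},\mu_{2,\mathrm c}\in\mathbb{R}_{\ge0}$ are the Lagrange multipliers of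 the four groups of constraints, in the order in which the constraints are listed. They are optimal if, together with some primal point, they satisfy the Karush-Kuhn-Tucker conditions of the problem.
   Formalization: Non-degeneracy is imposed at each q considered and also requires at most two active constraints with positive multipliers per body; with pairwise independence alone (i) fails, e.g. for two equal equilateral triangles with b=1, r=1/2 and close centres. *)

theory Defs
  imports "HOL-Analysis.Analysis"
begin

text \<open>
  A configuration is \<open>(c1, \<xi>1, c2, \<xi>2)\<close>, a primal point is \<open>(p, \<alpha>, y1, y2)\<close>, and a multiplier
  vector lists the multipliers of the two halfspace groups, then of the two disc constraints.
  On vectors, \<open>\<le>\<close> is componentwise and \<open>1\<close> is the all-ones vector.
\<close>

type_synonym config = "(real^2) \<times> real \<times> (real^2) \<times> real"
type_synonym primal = "(real^2) \<times> real \<times> (real^2) \<times> (real^2)"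
type_synonym ('m, 'n) dual = "(real^'m) \<times> (real^'n) \<times> real \<times> real"

definition rotation :: "real \<Rightarrow> real^2^2" where
  "rotation \<theta> = vector [vector [cos \<theta>, - sin \<theta>], vector [sin \<theta>, cos \<theta>]]"

text \<open>Componentwise strict inequality is spelled out, since \<open><\<close> on vectors means something weaker.\<close>

definition padded_polytope :: "real^2^'m \<Rightarrow> real^'m \<Rightarrow> real \<Rightarrow> bool" where
  "padded_polytope A b r \<longleftrightarrow>
     bounded {x. A *v x \<le> b} \<and> (\<forall>k. norm (row k A) = 1) \<and> (\<forall>k. b $ k - r > 0)"

definition hs_residual ::
  "real^2^'m \<Rightarrow> real^'m \<Rightarrow> real \<Rightarrow> real^2 \<Rightarrow> real \<Rightarrow> real \<Rightarrow> real^2 \<Rightarrow> real^'m" where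
  "hs_residual A b r c \<xi> \<alpha> y =
     (A ** transpose (rotation \<xi>)) *v (y - c) - (\<alpha> *\<^sub>R b - r *\<^sub>R 1)"

definition disc_residual :: "real \<Rightarrow> real^2 \<Rightarrow> real^2 \<Rightarrow> real" where
  "disc_residual r p y = (p - y) \<bullet> (p - y) - r\<^sup>2"

fun objective :: "primal \<Rightarrow> real" where
  "objective (p, \<alpha>, y1, y2) = \<alpha> - 1"

fun feasible ::
  "real^2^'m \<Rightarrow> real^'m \<Rightarrow> real^2^'n \<Rightarrow> real^'n \<Rightarrow> real \<Rightarrow> config \<Rightarrow> primal \<Rightarrow> bool" where
  "feasible A1 b1 A2 b2 r (c1, \<xi>1, c2, \<xi>2) (p, \<alpha>, y1, y2) \<longleftrightarrow>
     hs_residual A1 b1 r c1 \<xi>1 \<alpha> y1 \<le> 0 \<and> hs_residual A2 b2 r c2 \<xi>2 \<alpha> y2 \<le> 0 \<and>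
     disc_residual r p y1 \<le> 0 \<and> disc_residual r p y2 \<le> 0"

definition optimal_primal ::
  "real^2^'m \<Rightarrow> real^'m \<Rightarrow> real^2^'n \<Rightarrow> real^'n \<Rightarrow> real \<Rightarrow> config \<Rightarrow> primal \<Rightarrow> bool" where
  "optimal_primal A1 b1 A2 b2 r q z \<longleftrightarrow>
     feasible A1 b1 A2 b2 r q z \<and>
     (\<forall>z'. feasible A1 b1 A2 b2 r q z' \<longrightarrow> objective z \<le> objective z')"

definition min_value ::
  "real^2^'m \<Rightarrow> real^'m \<Rightarrow> real^2^'n \<Rightarrow> real^'n \<Rightarrow> real \<Rightarrow> config \<Rightarrow> real" where
  "min_value A1 b1 A2 b2 r q = (INF z\<in>{z. feasible A1 b1 A2 b2 r q z}. objective z)"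

fun lagrangian ::
  "real^2^'m \<Rightarrow> real^'m \<Rightarrow> real^2^'n \<Rightarrow> real^'n \<Rightarrow> real \<Rightarrow> config \<Rightarrow> ('m::finite, 'n::finite) dual \<Rightarrow> primal \<Rightarrow> real" where
  "lagrangian A1 b1 A2 b2 r (c1, \<xi>1, c2, \<xi>2) (\<mu>1p, \<mu>2p, \<mu>1c, \<mu>2c) (p, \<alpha>, y1, y2) =
     objective (p, \<alpha>, y1, y2) +
     \<mu>1p \<bullet> hs_residual A1 b1 r c1 \<xi>1 \<alpha> y1 + \<mu>2p \<bullet> hs_residual A2 b2 r c2 \<xi>2 \<alpha> y2 +
     \<mu>1c * disc_residual r p y1 + \<mu>2c * disc_residual r p y2"

fun dual_feasible :: "('m::finite, 'n::finite) dual \<Rightarrow> bool" where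
  "dual_feasible (\<mu>1p, \<mu>2p, \<mu>1c, \<mu>2c) \<longleftrightarrow> 0 \<le> \<mu>1p \<and> 0 \<le> \<mu>2p \<and> 0 \<le> \<mu>1c \<and> 0 \<le> \<mu>2c"

fun complementary ::
  "real^2^'m \<Rightarrow> real^'m \<Rightarrow> real^2^'n \<Rightarrow> real^'n \<Rightarrow> real \<Rightarrow> config \<Rightarrow> primal \<Rightarrow> ('m::finite, 'n::finite) dual \<Rightarrow> bool" where
  "complementary A1 b1 A2 b2 r (c1, \<xi>1, c2, \<xi>2) (p, \<alpha>, y1, y2) (\<mu>1p, \<mu>2p, \<mu>1c, \<mu>2c) \<longleftrightarrow>
     (\<forall>k. \<mu>1p $ k * hs_residual A1 b1 r c1 \<xi>1 \<alpha> y1 $ k = 0) \<and>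
     (\<forall>k. \<mu>2p $ k * hs_residual A2 b2 r c2 \<xi>2 \<alpha> y2 $ k = 0) \<and>
     \<mu>1c * disc_residual r p y1 = 0 \<and> \<mu>2c * disc_residual r p y2 = 0"

definition kkt ::
  "real^2^'m \<Rightarrow> real^'m \<Rightarrow> real^2^'n \<Rightarrow> real^'n \<Rightarrow> real \<Rightarrow> config \<Rightarrow> primal \<Rightarrow> ('m::finite, 'n::finite) dual \<Rightarrow> bool" where
  "kkt A1 b1 A2 b2 r q z \<mu> \<longleftrightarrow>
     (lagrangian A1 b1 A2 b2 r q \<mu> has_derivative (\<lambda>_. 0)) (at z) \<and>
     feasible A1 b1 A2 b2 r q z \<and> dual_feasible \<mu> \<and> complementary A1 b1 A2 b2 r q z \<mu>"

definition optimal_dual ::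
  "real^2^'m \<Rightarrow> real^'m \<Rightarrow> real^2^'n \<Rightarrow> real^'n \<Rightarrow> real \<Rightarrow> config \<Rightarrow> ('m::finite, 'n::finite) dual \<Rightarrow> bool" where
  "optimal_dual A1 b1 A2 b2 r q \<mu> \<longleftrightarrow> (\<exists>z. kkt A1 b1 A2 b2 r q z \<mu>)"

text \<open>
  \<open>g\<close> is the vector of residuals of one body. Besides invertibility of the matrix formed by any
  two rows that are active with positive multipliers, at most two such rows are allowed.
  Pairwise invertibility alone does not give uniqueness of the multipliers: for two copies of an
  equilateral triangle with \<open>b = 1\<close>, \<open>r = 1/2\<close>, \<open>\<xi>1 = \<xi>2 = 0\<close> and \<open>0 < norm (c1 - c2) < 1\<close>, the optimum
  is \<open>\<alpha> = 1/2\<close>, and for every \<open>t\<close> in \<open>[0, 1]\<close> the vector with all components \<open>t/3\<close> for the first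
  triangle, \<open>(1-t)/3\<close> for the second, and zero for the discs is optimal.
\<close>

definition independent_active :: "real^2^'m \<Rightarrow> real^'m \<Rightarrow> real^'m \<Rightarrow> bool" where
  "independent_active A g \<mu> \<longleftrightarrow>
     (\<forall>j k. j \<noteq> k \<and> g $ j = 0 \<and> \<mu> $ j > 0 \<and> g $ k = 0 \<and> \<mu> $ k > 0 \<longrightarrow>
        invertible (vector [row j A, row k A] :: real^2^2)) \<and>
     card {k. g $ k = 0 \<and> \<mu> $ k > 0} \<le> 2"

text \<open>
  Non-degeneracy is a condition at a configuration. It cannot hold at all configurations with
  \<open>c1 \<noteq> c2\<close>: scaling down a bounded body until it is about to become empty yields active rows with
  positive multipliers whose normals sum to zero, and this determines the optimum when the
  centres are close enough.
\<close>

definition nondegenerate ::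
  "real^2^'m \<Rightarrow> real^'m \<Rightarrow> real^2^'n \<Rightarrow> real^'n \<Rightarrow> real \<Rightarrow> config \<Rightarrow> bool" where
  "nondegenerate A1 b1 A2 b2 r = (\<lambda>(c1, \<xi>1, c2, \<xi>2).
     \<forall>p \<alpha> y1 y2 \<mu>1p \<mu>2p \<mu>1c \<mu>2c.
       kkt A1 b1 A2 b2 r (c1, \<xi>1, c2, \<xi>2) (p, \<alpha>, y1, y2) (\<mu>1p, \<mu>2p, \<mu>1c, \<mu>2c) \<longrightarrow>
         independent_active A1 (hs_residual A1 b1 r c1 \<xi>1 \<alpha> y1) \<mu>1p \<and>
         independent_active A2 (hs_residual A2 b2 r c2 \<xi>2 \<alpha> y2) \<mu>2p)"

definition scaled_padded ::
  "real^2^'m \<Rightarrow> real^'m \<Rightarrow> real \<Rightarrow> real^2 \<Rightarrow> real \<Rightarrow> real \<Rightarrow> (real^2) set" where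
  "scaled_padded A b r c \<xi> \<alpha> = {p. \<exists>y. hs_residual A b r c \<xi> \<alpha> y \<le> 0 \<and> norm (p - y) \<le> r}"

definition patch_contact ::
  "real^2^'m \<Rightarrow> real^'m \<Rightarrow> real^2^'n \<Rightarrow> real^'n \<Rightarrow> real \<Rightarrow> config \<Rightarrow> bool" where
  "patch_contact A1 b1 A2 b2 r = (\<lambda>(c1, \<xi>1, c2, \<xi>2).
     let \<alpha> = min_value A1 b1 A2 b2 r (c1, \<xi>1, c2, \<xi>2) + 1 in
     \<exists>p p'. p \<noteq> p' \<and>
       {p, p'} \<subseteq> frontier (scaled_padded A1 b1 r c1 \<xi>1 \<alpha>) \<inter> frontier (scaled_padded A2 b2 r c2 \<xi>2 \<alpha>))"

end

theory Submission imports Defs begin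

text \<open>
  The problem is convex and has a Slater point, so multipliers exist, and every optimal multiplier
  vector satisfies the KKT conditions together with every optimal primal point. Given two
  multiplier vectors at one primal point, their midpoint is again optimal and its support contains
  both supports, so by non-degeneracy the active normals of each body carrying either vector are
  linearly independent. Hence the halfspace multipliers are determined by the contact force, which
  has fixed direction \<open>p - y1\<close> and magnitude proportional to the disc multiplier; the two vectors are
  proportional, and stationarity in \<open>\<alpha>\<close> fixes the scale. Continuity follows because KKT pairs stay
  bounded and form a closed set. Conversely the unique multipliers fix \<open>p - y1\<close> and \<open>p - y2\<close>, and the
  force exposes \<open>p\<close> in both scaled padded bodies, so two optimal points would form a patch contact.
\<close>

section \<open>Lagrange multipliers and rotated facets\<close>

text \<open>Reads the sign of a component of a separating normal off a direction in which the
  separated set is unbounded.\<close>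

lemma nonneg_slope:
  fixes c K :: real
  assumes "\<And>w. 0 \<le> w \<Longrightarrow> 0 \<le> K + w * c"
  shows "0 \<le> c"
proof (rule ccontr)
  assume "\<not> 0 \<le> c"
  then have "c < 0" by simp
  then have "0 \<le> (\<bar>K\<bar> + 1) / - c" by (intro divide_nonneg_pos) auto
  from assms[OF this] have "0 \<le> K - (\<bar>K\<bar> + 1)" using \<open>c < 0\<close> by simp
  then show False by linarith
qed

text \<open>Strong duality by separation: the pairs dominating some \<open>(f x - m, g x)\<close>
  form a convex set that misses the origin, and upward closure makes the components of a separating
  normal nonnegative. The Slater point forces the component \<open>l\<close> along the objective to
  be positive, and dividing by it yields the multiplier.\<close>

lemma slater_multiplier:
  fixes f :: "'a::real_vector \<Rightarrow> real" and g :: "'a \<Rightarrow> 'b::ordered_euclidean_space"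
  assumes f: "convex_on UNIV f"
    and g: "\<And>x y u v. 0 \<le> u \<Longrightarrow> 0 \<le> v \<Longrightarrow> u + v = 1 \<Longrightarrow>
      g (u *\<^sub>R x + v *\<^sub>R y) \<le> u *\<^sub>R g x + v *\<^sub>R g y"
    and slater: "\<And>i. i \<in> Basis \<Longrightarrow> g x0 \<bullet> i < 0"
    and opt: "\<And>x. g x \<le> 0 \<Longrightarrow> m \<le> f x"
  shows "\<exists>\<mu>\<ge>0. \<forall>x. m \<le> f x + \<mu> \<bullet> g x"
proof -
  \<comment> \<open>The strict inequality keeps \<open>0\<close> out of \<open>S\<close> even when
    the value \<open>m\<close> is attained.\<close>
  define S where "S = {(s, t). \<exists>x. f x - m < s \<and> g x \<le> t}"
  have "convex S"
    unfolding convex_def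
  proof (intro ballI allI impI)
    fix a b :: "real \<times> 'b" and u v :: real
    assume ab: "a \<in> S" "b \<in> S" and uv: "0 \<le> u" "0 \<le> v" "u + v = 1"
    obtain s t x where a: "a = (s, t)" "f x - m < s" "g x \<le> t" using ab(1) by (auto simp: S_def)
    obtain s' t' x' where b: "b = (s', t')" "f x' - m < s'" "g x' \<le> t'" using ab(2) by (auto simp: S_def)
    have "f (u *\<^sub>R x + v *\<^sub>R x') \<le> u * f x + v * f x'"
      using f uv unfolding convex_on_def by auto
    moreover have "u * (f x - m) + v * (f x' - m) < u * s + v * s'"
    proof (cases "u = 0")
      case False
      then have "u * (f x - m) < u * s" "v * (f x' - m) \<le> v * s'"
        using a b uv by (auto intro!: mult_strict_left_mono mult_left_mono)
      then show ?thesis by linarith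
    qed (use uv b in auto)
    moreover have "u * (f x - m) + v * (f x' - m) = u * f x + v * f x' - (u + v) * m"
      by (simp add: algebra_simps)
    ultimately have "f (u *\<^sub>R x + v *\<^sub>R x') - m < u * s + v * s'" using uv by simp
    moreover have "g (u *\<^sub>R x + v *\<^sub>R x') \<le> u *\<^sub>R t + v *\<^sub>R t'"
      using g[OF uv] a(3) b(3) uv by (meson add_mono order_trans scaleR_left_mono)
    ultimately show "u *\<^sub>R a + v *\<^sub>R b \<in> S" by (auto simp: S_def a b)
  qed
  moreover have "0 \<notin> S" using opt by (force simp: S_def zero_prod_def)
  ultimately obtain a where a: "a \<noteq> 0" "\<And>x. x \<in> S \<Longrightarrow> 0 \<le> a \<bullet> x"
    using separating_hyperplane_set_0[of S] by blast
  obtain l \<nu> where l: "a = (l, \<nu>)" by (cases a)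
  have sep: "0 \<le> l * s + \<nu> \<bullet> t" if "f x - m < s" "g x \<le> t" for s t x
    using a(2)[of "(s, t)"] that by (auto simp: S_def l)
  have "0 \<le> l"
  proof (rule nonneg_slope)
    fix w :: real assume "0 \<le> w"
    then show "0 \<le> (l * (f x0 - m + 1) + \<nu> \<bullet> g x0) + w * l"
      using sep[of x0 "f x0 - m + 1 + w" "g x0"] by (simp add: algebra_simps)
  qed
  have \<nu>: "0 \<le> \<nu> \<bullet> i" if i: "i \<in> Basis" for i
  proof (rule nonneg_slope)
    fix w :: real assume "0 \<le> w"
    then have "g x0 \<le> g x0 + w *\<^sub>R i"
      unfolding eucl_le[of "g x0"] using i by (auto simp: inner_add_left inner_Basis)
    then show "0 \<le> (l * (f x0 - m + 1) + \<nu> \<bullet> g x0) + w * (\<nu> \<bullet> i)"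
      using sep[of x0 "f x0 - m + 1" "g x0 + w *\<^sub>R i"] by (simp add: inner_add_right)
  qed
  \<comment> \<open>The strict inequality in \<open>S\<close> excludes \<open>s = f x - m\<close>
    for this \<open>x\<close>, so a slack is added and sent to zero. The \<open>+ 1\<close> in
    \<open>e / (l + 1)\<close> avoids dividing by \<open>l\<close>, which may still be zero
    here.\<close>
  have lim: "0 \<le> l * (f x - m) + \<nu> \<bullet> g x" for x
  proof (rule field_le_epsilon)
    fix e :: real assume e: "0 < e"
    have "0 \<le> l * (f x - m + e / (l + 1)) + \<nu> \<bullet> g x"
      using sep[of x "f x - m + e / (l + 1)" "g x"] e \<open>0 \<le> l\<close> by simp
    moreover have "l * (e / (l + 1)) \<le> e" using e \<open>0 \<le> l\<close> by (simp add: field_simps)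
    ultimately show "0 \<le> l * (f x - m) + \<nu> \<bullet> g x + e" by (simp add: distrib_left)
  qed
  \<comment> \<open>Otherwise \<nu> is nonzero and nonnegative with
    \<open>0 \<le> \<nu> \<bullet> g x0\<close>, although every component of \<open>g x0\<close> is
    negative.\<close>
  have "l \<noteq> 0"
  proof
    assume l0: "l = 0"
    then have "\<nu> \<noteq> 0" using a(1) by (simp add: l zero_prod_def)
    then obtain j where j: "j \<in> Basis" "\<nu> \<bullet> j \<noteq> 0" using euclidean_eq_iff[of \<nu> 0] by auto
    have "\<nu> \<bullet> g x0 = (\<Sum>i\<in>Basis. (\<nu> \<bullet> i) * (g x0 \<bullet> i))" by (rule euclidean_inner)
    also have "\<dots> < 0"
    proof -
      have "(\<nu> \<bullet> i) * (g x0 \<bullet> i) \<le> 0" if "i \<in> Basis" for i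
        using \<nu>[OF that] slater[OF that] by (simp add: mult_nonneg_nonpos)
      moreover have "(\<nu> \<bullet> j) * (g x0 \<bullet> j) < 0"
        using \<nu>[OF j(1)] slater[OF j(1)] j by (simp add: mult_pos_neg)
      ultimately show ?thesis
        using j(1) sum_strict_mono_ex1[of Basis "\<lambda>i. (\<nu> \<bullet> i) * (g x0 \<bullet> i)" "\<lambda>_. 0"] by auto
    qed
    finally show False using lim[of x0] l0 by simp
  qed
  then have pos: "0 < l" using \<open>0 \<le> l\<close> by simp
  show ?thesis
  proof (intro exI conjI allI)
    have "0 \<le> \<nu>" unfolding eucl_le[of 0] using \<nu> by simp
    then show "0 \<le> inverse l *\<^sub>R \<nu>" using pos by (intro scaleR_nonneg_nonneg) auto
    have "0 \<le> inverse l * (l * (f x - m) + \<nu> \<bullet> g x)" for x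
      using lim[of x] pos by (intro mult_nonneg_nonneg) auto
    then have "0 \<le> f x - m + inverse l * (\<nu> \<bullet> g x)" for x
      using pos by (simp add: distrib_left flip: mult.assoc)
    then show "m \<le> f x + (inverse l *\<^sub>R \<nu>) \<bullet> g x" for x
      by (simp add: algebra_simps)
  qed
qed

section \<open>Rotations and facet normals in the world frame\<close>

lemma rotation_transpose_mult: "rotation \<xi> ** transpose (rotation \<xi>) = mat 1"
proof -
  have "sin \<xi> * sin \<xi> + cos \<xi> * cos \<xi> = 1" using sin_cos_squared_add[of \<xi>] by (simp add: power2_eq_square)
  then show ?thesis
  by (simp add: rotation_def vec_eq_iff forall_2 matrix_matrix_mult_def transpose_def sum_2 mat_def
      power2_eq_square [symmetric] algebra_simps)
qed

lemma orthogonal_rotation: "orthogonal_matrix (rotation \<xi>)"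
  using rotation_transpose_mult matrix_left_right_inverse by (auto simp: orthogonal_matrix_def)

lemma norm_mult_rotation: "norm (x v* rotation \<xi>) = norm x"
proof -
  have "orthogonal_transformation ((*v) (transpose (rotation \<xi>)))"
    by (simp add: orthogonal_transformation_matrix orthogonal_rotation del: transpose_matrix_vector)
  then show ?thesis using orthogonal_transformation_norm by fastforce
qed

text \<open>The rows are the facet normals after rotation by \<xi>. The product
  \<open>m v* facets A \<xi>\<close> is then the resultant of forces of magnitudes \<open>m\<close>
  along these normals.\<close>

definition facets :: "real^2^'m \<Rightarrow> real \<Rightarrow> real^2^'m" where
  "facets A \<xi> = A ** transpose (rotation \<xi>)"

lemma facets_mult: "facets A \<xi> *v x = A *v (x v* rotation \<xi>)"
  by (simp add: facets_def flip: matrix_vector_mul_assoc)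

lemma mult_facets: "m v* facets A \<xi> = rotation \<xi> *v (m v* A)"
  by (simp add: facets_def flip: vector_matrix_mul_assoc)

text \<open>Rotation preserves linear dependence of the normals, so non-degeneracy, which speaks of
  rows of \<open>A\<close>, can be used for the rotated body.\<close>

lemma mult_facets_eq_0: "m v* facets A \<xi> = 0 \<longleftrightarrow> m v* A = 0"
proof -
  have "inj ((*v) (rotation \<xi>))"
    using orthogonal_rotation[of \<xi>] by (intro inj_matrix_vector_mult) (auto simp: invertible_def orthogonal_matrix_def)
  then show ?thesis by (metis mult_facets inj_eq matrix_vector_mult_0_right)
qed

lemma hs_residual_facets: "hs_residual A b r c \<xi> \<alpha> y = facets A \<xi> *v (y - c) - (\<alpha> *\<^sub>R b - r *\<^sub>R 1)"
  by (simp add: hs_residual_def facets_def)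

lemma norm_row_mult_le:
  assumes "norm (row k A) = 1"
  shows "\<bar>(facets A \<xi> *v x) $ k\<bar> \<le> norm x"
proof -
  have "(facets A \<xi> *v x) $ k = row k A \<bullet> (x v* rotation \<xi>)"
    by (simp add: facets_mult matrix_vector_mul_component row_def)
  then show ?thesis using Cauchy_Schwarz_ineq2[of "row k A" "x v* rotation \<xi>"] assms
    by (simp add: norm_mult_rotation)
qed

text \<open>Rotated back, \<open>y - c\<close> becomes some \<open>x\<close> with
  \<open>A *v x\<close> at most \<open>\<alpha> *\<^sub>R b - r *\<^sub>R 1\<close>. If \<alpha>
  were not positive, all entries of \<open>A *v x\<close> would be negative and the ray through
  \<open>x\<close> would stay in the bounded polytope. Otherwise \<open>x\<close> divided by
  \<alpha> lies in that polytope. The bound does not depend on position or orientation.\<close>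

lemma padded_polytope_bounds:
  assumes P: "padded_polytope A b r" and r: "r > 0"
  shows "\<exists>C. \<forall>c \<xi> \<alpha> y. hs_residual A b r c \<xi> \<alpha> y \<le> 0 \<and> \<alpha> \<le> M \<longrightarrow> 0 < \<alpha> \<and> norm (y - c) \<le> C"
proof -
  obtain B where B: "\<And>x. A *v x \<le> b \<Longrightarrow> norm x \<le> B"
    using P by (auto simp: padded_polytope_def bounded_iff)
  have "b $ k > r" for k using P by (simp add: padded_polytope_def)
  then have b: "b $ k > r" "b $ k > 0" for k using r less_trans by blast+
  have "0 < \<alpha> \<and> norm (y - c) \<le> \<bar>M\<bar> * B"
    if h: "hs_residual A b r c \<xi> \<alpha> y \<le> 0" and M: "\<alpha> \<le> M" for c \<xi> \<alpha> y
  proof -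
    define x where "x = (y - c) v* rotation \<xi>"
    have x: "(A *v x) $ k \<le> \<alpha> * b $ k - r" for k
      using h by (auto simp: hs_residual_facets facets_mult x_def less_eq_vec_def)
    have \<alpha>: "0 < \<alpha>"
    proof (rule ccontr)
      assume "\<not> 0 < \<alpha>"
      then have neg: "(A *v x) $ k < 0" for k
        using x[of k] b(2)[of k] r mult_nonpos_nonneg[of \<alpha> "b $ k"] by linarith
      then have "x \<noteq> 0" by (metis matrix_vector_mult_0_right less_irrefl zero_index)
      \<comment> \<open>Stretches \<open>x\<close> to length \<open>\<bar>B\<bar> + 1\<close>, which
        exceeds the bound \<open>B\<close>.\<close>
      define t where "t = (\<bar>B\<bar> + 1) / norm x"
      have "t > 0" using \<open>x \<noteq> 0\<close> by (simp add: t_def add_nonneg_pos)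
      then have "(A *v (t *\<^sub>R x)) $ k \<le> b $ k" for k
        using mult_pos_neg[OF _ neg[of k], of t] b(2)[of k] by (simp add: matrix_vector_mult_scaleR)
      then have "A *v (t *\<^sub>R x) \<le> b" by (simp add: less_eq_vec_def)
      from B[OF this] show False using \<open>t > 0\<close> \<open>x \<noteq> 0\<close> by (simp add: t_def)
    qed
    have "(A *v x) $ k \<le> \<alpha> * b $ k" for k using x[of k] r by linarith
    then have "A *v (x /\<^sub>R \<alpha>) \<le> b"
      using \<alpha> by (simp add: less_eq_vec_def matrix_vector_mult_scaleR field_simps)
    from B[OF this] have "norm x \<le> \<alpha> * B" using \<alpha> by (simp add: field_simps)
    moreover have "0 \<le> B" using B[of 0] b(2) by (simp add: less_eq_vec_def less_imp_le)
    moreover have "\<alpha> * B \<le> \<bar>M\<bar> * B" using M \<alpha> \<open>0 \<le> B\<close> by (intro mult_right_mono) auto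
    ultimately show ?thesis using \<alpha> by (simp add: x_def norm_mult_rotation)
  qed
  then show ?thesis by blast
qed

section \<open>The KKT conditions as a lower bound\<close>

fun lagrangian_gradient ::
  "real^2^'m \<Rightarrow> real^'m \<Rightarrow> real^2^'n \<Rightarrow> real^'n \<Rightarrow> config \<Rightarrow> ('m::finite, 'n::finite) dual \<Rightarrow> primal \<Rightarrow> primal" where
  "lagrangian_gradient A1 b1 A2 b2 (c1, \<xi>1, c2, \<xi>2) (m1, m2, k1, k2) (p, \<alpha>, y1, y2) =
     ((2 * k1) *\<^sub>R (p - y1) + (2 * k2) *\<^sub>R (p - y2), 1 - m1 \<bullet> b1 - m2 \<bullet> b2,
      m1 v* facets A1 \<xi>1 - (2 * k1) *\<^sub>R (p - y1), m2 v* facets A2 \<xi>2 - (2 * k2) *\<^sub>R (p - y2))"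

lemma inner_hs_residual:
  "m \<bullet> hs_residual A b r c \<xi> \<alpha> y = (m v* facets A \<xi>) \<bullet> (y - c) - \<alpha> * (m \<bullet> b) + r * (m \<bullet> 1)"
  by (simp add: hs_residual_facets dot_lmul_matrix inner_diff_right matrix_vector_mult_diff_distrib)

lemma disc_residual_expansion:
  "disc_residual r p' y' = disc_residual r p y + 2 * ((p - y) \<bullet> ((p' - p) - (y' - y))) +
     ((p' - p) - (y' - y)) \<bullet> ((p' - p) - (y' - y))"
proof -
  define u v where "u = p - y" and "v = (p' - p) - (y' - y)"
  have "p' - y' = u + v" by (simp add: u_def v_def)
  then show ?thesis
    unfolding disc_residual_def by (simp add: inner_add_left inner_add_right inner_commute flip: u_def v_def)
qed

text \<open>The Lagrangian is quadratic, so its second-order expansion is exact. The remainder is a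
  sum of squares weighted by the disc multipliers; it vanishes to second order, which gives the
  derivative, and it is nonnegative for dual feasible multipliers, which makes critical points
  global minimisers.\<close>

lemma lagrangian_expansion:
  "lagrangian A1 b1 A2 b2 r q (m1, m2, k1, k2) z' =
     lagrangian A1 b1 A2 b2 r q (m1, m2, k1, k2) z +
     (z' - z) \<bullet> lagrangian_gradient A1 b1 A2 b2 q (m1, m2, k1, k2) z +
     k1 * (((fst z' - fst z) - (fst (snd (snd z')) - fst (snd (snd z)))) \<bullet>
           ((fst z' - fst z) - (fst (snd (snd z')) - fst (snd (snd z))))) +
     k2 * (((fst z' - fst z) - (snd (snd (snd z')) - snd (snd (snd z)))) \<bullet>
           ((fst z' - fst z) - (snd (snd (snd z')) - snd (snd (snd z)))))"
proof -
  obtain c1 \<xi>1 c2 \<xi>2 where q: "q = (c1, \<xi>1, c2, \<xi>2)" by (cases q)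
  obtain p \<alpha> y1 y2 where z: "z = (p, \<alpha>, y1, y2)" by (cases z)
  obtain p' \<alpha>' y1' y2' where z': "z' = (p', \<alpha>', y1', y2')" by (cases z')
  have h: "m \<bullet> hs_residual A b r c \<xi> \<alpha>' y' =
      m \<bullet> hs_residual A b r c \<xi> \<alpha> y + (y' - y) \<bullet> (m v* facets A \<xi>) - (\<alpha>' - \<alpha>) * (m \<bullet> b)"
    for A :: "real^2^'i" and b m c \<xi> y' y
    unfolding inner_hs_residual by (simp add: inner_diff_left inner_diff_right inner_commute left_diff_distrib)
  define d e1 e2 u1 u2 where "d = p' - p" and "e1 = y1' - y1" and "e2 = y2' - y2"
    and "u1 = p - y1" and "u2 = p - y2"
  have "lagrangian A1 b1 A2 b2 r q (m1, m2, k1, k2) z' = \<alpha>' - 1 +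
      (m1 \<bullet> hs_residual A1 b1 r c1 \<xi>1 \<alpha> y1 + e1 \<bullet> (m1 v* facets A1 \<xi>1) - (\<alpha>' - \<alpha>) * (m1 \<bullet> b1)) +
      (m2 \<bullet> hs_residual A2 b2 r c2 \<xi>2 \<alpha> y2 + e2 \<bullet> (m2 v* facets A2 \<xi>2) - (\<alpha>' - \<alpha>) * (m2 \<bullet> b2)) +
      k1 * (disc_residual r p y1 + 2 * (u1 \<bullet> (d - e1)) + (d - e1) \<bullet> (d - e1)) +
      k2 * (disc_residual r p y2 + 2 * (u2 \<bullet> (d - e2)) + (d - e2) \<bullet> (d - e2))"
    unfolding q z' lagrangian.simps objective.simps d_def e1_def e2_def u1_def u2_def
      h[of m1 A1 b1 c1 \<xi>1 y1' y1] h[of m2 A2 b2 c2 \<xi>2 y2' y2]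
      disc_residual_expansion[of r p' y1' p y1] disc_residual_expansion[of r p' y2' p y2] ..
  also have "\<dots> = (\<alpha> - 1 + m1 \<bullet> hs_residual A1 b1 r c1 \<xi>1 \<alpha> y1 + m2 \<bullet> hs_residual A2 b2 r c2 \<xi>2 \<alpha> y2 +
       k1 * disc_residual r p y1 + k2 * disc_residual r p y2) +
      (d \<bullet> ((2 * k1) *\<^sub>R u1 + (2 * k2) *\<^sub>R u2) + (\<alpha>' - \<alpha>) * (1 - m1 \<bullet> b1 - m2 \<bullet> b2) +
       e1 \<bullet> (m1 v* facets A1 \<xi>1 - (2 * k1) *\<^sub>R u1) + e2 \<bullet> (m2 v* facets A2 \<xi>2 - (2 * k2) *\<^sub>R u2)) +
      k1 * ((d - e1) \<bullet> (d - e1)) + k2 * ((d - e2) \<bullet> (d - e2))"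
    by (simp add: inner_add_right inner_diff_right[of u1] inner_diff_right[of u2]
        inner_diff_right[of e1] inner_diff_right[of e2] inner_commute[of u1] inner_commute[of u2]
        inner_diff_left[of _ _ u1] inner_diff_left[of _ _ u2] mult.assoc
        distrib_left distrib_right left_diff_distrib right_diff_distrib)
  finally show ?thesis
    by (simp add: q z z' d_def e1_def e2_def u1_def u2_def)
qed

lemma lagrangian_has_derivative:
  "(lagrangian A1 b1 A2 b2 r q \<mu> has_derivative
     (\<lambda>w. w \<bullet> lagrangian_gradient A1 b1 A2 b2 q \<mu> z)) (at z)"
proof -
  obtain m1 m2 k1 k2 where \<mu>: "\<mu> = (m1, m2, k1, k2)" by (cases \<mu>)
  \<comment> \<open>After rewriting by the exact expansion about \<open>z\<close>, the square terms
    have derivative zero there.\<close>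
  show ?thesis
    unfolding \<mu>
    by (subst ext[OF lagrangian_expansion[of A1 b1 A2 b2 r q m1 m2 k1 k2 _ z]])
      (auto intro!: derivative_eq_intros)
qed

lemma lagrangian_critical_iff:
  "(lagrangian A1 b1 A2 b2 r q \<mu> has_derivative (\<lambda>_. 0)) (at z) \<longleftrightarrow>
     lagrangian_gradient A1 b1 A2 b2 q \<mu> z = 0"
proof
  assume "(lagrangian A1 b1 A2 b2 r q \<mu> has_derivative (\<lambda>_. 0)) (at z)"
  then have "(\<lambda>w. w \<bullet> lagrangian_gradient A1 b1 A2 b2 q \<mu> z) = (\<lambda>_. 0)"
    using has_derivative_unique lagrangian_has_derivative by blast
  then show "lagrangian_gradient A1 b1 A2 b2 q \<mu> z = 0" by (metis inner_eq_zero_iff)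
next
  assume "lagrangian_gradient A1 b1 A2 b2 q \<mu> z = 0"
  then show "(lagrangian A1 b1 A2 b2 r q \<mu> has_derivative (\<lambda>_. 0)) (at z)"
    using lagrangian_has_derivative[of A1 b1 A2 b2 r q \<mu> z] by simp
qed

lemma inner_nonneg_nonpos_vec:
  fixes m g :: "real^'m"
  assumes "0 \<le> m" "g \<le> 0"
  shows "m \<bullet> g \<le> 0" and "m \<bullet> g = 0 \<Longrightarrow> m $ k * g $ k = 0"
proof -
  have le: "m $ k * g $ k \<le> 0" for k
    using assms by (simp add: less_eq_vec_def mult_nonneg_nonpos)
  then show "m \<bullet> g \<le> 0" by (simp add: inner_vec_def sum_nonpos)
  assume "m \<bullet> g = 0"
  then show "m $ k * g $ k = 0"
    using le sum_nonneg_eq_0_iff[of UNIV "\<lambda>k. - (m $ k * g $ k)"] by (simp add: inner_vec_def sum_negf)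
qed

text \<open>Weak duality: each multiplier term is nonpositive at a feasible point. If their sum is
  not negative, every single product vanishes, which is complementarity.\<close>

lemma lagrangian_le_objective:
  assumes "feasible A1 b1 A2 b2 r q z" "dual_feasible \<mu>"
  shows "lagrangian A1 b1 A2 b2 r q \<mu> z \<le> objective z"
    and "objective z \<le> lagrangian A1 b1 A2 b2 r q \<mu> z \<Longrightarrow> complementary A1 b1 A2 b2 r q z \<mu>"
proof -
  obtain c1 \<xi>1 c2 \<xi>2 where q: "q = (c1, \<xi>1, c2, \<xi>2)" by (cases q)
  obtain p \<alpha> y1 y2 where z: "z = (p, \<alpha>, y1, y2)" by (cases z)
  obtain m1 m2 k1 k2 where \<mu>: "\<mu> = (m1, m2, k1, k2)" by (cases \<mu>)
  let ?g1 = "hs_residual A1 b1 r c1 \<xi>1 \<alpha> y1" and ?g2 = "hs_residual A2 b2 r c2 \<xi>2 \<alpha> y2"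
  have f: "0 \<le> m1" "0 \<le> m2" "0 \<le> k1" "0 \<le> k2" "?g1 \<le> 0" "?g2 \<le> 0"
    "disc_residual r p y1 \<le> 0" "disc_residual r p y2 \<le> 0"
    using assms by (auto simp: q z \<mu>)
  note nonpos = inner_nonneg_nonpos_vec(1)[OF f(1,5)] inner_nonneg_nonpos_vec(1)[OF f(2,6)]
    mult_nonneg_nonpos[OF f(3,7)] mult_nonneg_nonpos[OF f(4,8)]
  show "lagrangian A1 b1 A2 b2 r q \<mu> z \<le> objective z" using nonpos by (simp add: q z \<mu>)
  assume "objective z \<le> lagrangian A1 b1 A2 b2 r q \<mu> z"
  then have "m1 \<bullet> ?g1 = 0" "m2 \<bullet> ?g2 = 0" "k1 * disc_residual r p y1 = 0" "k2 * disc_residual r p y2 = 0"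
    using nonpos unfolding q z \<mu> lagrangian.simps by linarith+
  then show "complementary A1 b1 A2 b2 r q z \<mu>"
    using inner_nonneg_nonpos_vec(2)[OF f(1,5)] inner_nonneg_nonpos_vec(2)[OF f(2,6)]
    by (simp add: q z \<mu>)
qed

text \<open>
  In this form the KKT conditions depend on the primal point only through its objective value, so
  multipliers can be exchanged between optimal primal points.
\<close>

lemma kkt_iff_lower_bound:
  "kkt A1 b1 A2 b2 r q z \<mu> \<longleftrightarrow> feasible A1 b1 A2 b2 r q z \<and> dual_feasible \<mu> \<and>
     (\<forall>z'. objective z \<le> lagrangian A1 b1 A2 b2 r q \<mu> z')"
proof (intro iffI conjI allI)
  assume k: "kkt A1 b1 A2 b2 r q z \<mu>"
  then show "feasible A1 b1 A2 b2 r q z" "dual_feasible \<mu>" by (simp_all add: kkt_def)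
  fix z'
  obtain c1 \<xi>1 c2 \<xi>2 where q: "q = (c1, \<xi>1, c2, \<xi>2)" by (cases q)
  obtain p \<alpha> y1 y2 where z: "z = (p, \<alpha>, y1, y2)" by (cases z)
  obtain m1 m2 k1 k2 where \<mu>: "\<mu> = (m1, m2, k1, k2)" by (cases \<mu>)
  have "m1 \<bullet> hs_residual A1 b1 r c1 \<xi>1 \<alpha> y1 = 0" "m2 \<bullet> hs_residual A2 b2 r c2 \<xi>2 \<alpha> y2 = 0"
    using k by (auto simp: kkt_def q z \<mu> inner_vec_def intro!: sum.neutral)
  then have "lagrangian A1 b1 A2 b2 r q \<mu> z = objective z"
    using k by (auto simp: kkt_def q z \<mu>)
  moreover have "lagrangian_gradient A1 b1 A2 b2 q \<mu> z = 0"
    using k by (simp add: kkt_def lagrangian_critical_iff)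
  moreover have "0 \<le> k1" "0 \<le> k2" using k by (auto simp: kkt_def \<mu>)
  ultimately show "objective z \<le> lagrangian A1 b1 A2 b2 r q \<mu> z'"
    using lagrangian_expansion[of A1 b1 A2 b2 r q m1 m2 k1 k2 z' z] by (simp add: \<mu>)
next
  assume h: "feasible A1 b1 A2 b2 r q z \<and> dual_feasible \<mu> \<and>
     (\<forall>z'. objective z \<le> lagrangian A1 b1 A2 b2 r q \<mu> z')"
  note le = lagrangian_le_objective[of A1 b1 A2 b2 r q z \<mu>]
  \<comment> \<open>Together with weak duality at \<open>z\<close>, the lower bound makes
    \<open>z\<close> a global minimiser of the Lagrangian, hence a critical point.\<close>
  have "lagrangian A1 b1 A2 b2 r q \<mu> z \<le> lagrangian A1 b1 A2 b2 r q \<mu> z'" for z'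
    using h le(1) order_trans by blast
  then have "(\<lambda>w. w \<bullet> lagrangian_gradient A1 b1 A2 b2 q \<mu> z) = (\<lambda>v. 0)"
    using differential_zero_maxmin[OF UNIV_I open_UNIV lagrangian_has_derivative] by blast
  moreover have "complementary A1 b1 A2 b2 r q z \<mu>" using h le(2) by blast
  ultimately show "kkt A1 b1 A2 b2 r q z \<mu>"
    using h lagrangian_has_derivative[of A1 b1 A2 b2 r q \<mu> z] by (simp add: kkt_def)
qed

lemma kkt_imp_optimal_primal:
  assumes "kkt A1 b1 A2 b2 r q z \<mu>"
  shows "optimal_primal A1 b1 A2 b2 r q z"
  using assms lagrangian_le_objective(1) unfolding kkt_iff_lower_bound optimal_primal_def
  by (blast intro: order_trans)

lemma kkt_exchange:
  assumes "kkt A1 b1 A2 b2 r q z \<mu>" "optimal_primal A1 b1 A2 b2 r q z'"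
  shows "kkt A1 b1 A2 b2 r q z' \<mu>"
  using assms unfolding kkt_iff_lower_bound optimal_primal_def by (meson order_trans)

text \<open>The Lagrangian is affine in the multipliers, so the lower bound survives averaging. The
  average of two nonnegative vectors is positive wherever either of them is.\<close>

lemma kkt_midpoint:
  assumes "kkt A1 b1 A2 b2 r q z \<mu>" "kkt A1 b1 A2 b2 r q z \<mu>'"
  shows "kkt A1 b1 A2 b2 r q z ((1 / 2) *\<^sub>R (\<mu> + \<mu>'))"
proof -
  obtain c1 \<xi>1 c2 \<xi>2 where q: "q = (c1, \<xi>1, c2, \<xi>2)" by (cases q)
  obtain m1 m2 k1 k2 where \<mu>: "\<mu> = (m1, m2, k1, k2)" by (cases \<mu>)
  obtain m1' m2' k1' k2' where \<mu>': "\<mu>' = (m1', m2', k1', k2')" by (cases \<mu>')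
  have avg: "lagrangian A1 b1 A2 b2 r q ((1 / 2) *\<^sub>R (\<mu> + \<mu>')) w =
      (lagrangian A1 b1 A2 b2 r q \<mu> w + lagrangian A1 b1 A2 b2 r q \<mu>' w) / 2" for w
    by (cases w) (simp add: q \<mu> \<mu>' inner_add_left algebra_simps add_divide_distrib)
  have df: "dual_feasible ((1 / 2) *\<^sub>R (\<mu> + \<mu>'))"
    using assms by (auto simp: kkt_def \<mu> \<mu>' less_eq_vec_def)
  have le: "objective z \<le> lagrangian A1 b1 A2 b2 r q \<mu> w" "objective z \<le> lagrangian A1 b1 A2 b2 r q \<mu>' w" for w
    using assms unfolding kkt_iff_lower_bound by blast+
  have "objective z \<le> lagrangian A1 b1 A2 b2 r q ((1 / 2) *\<^sub>R (\<mu> + \<mu>')) w" for w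
    using add_mono[OF le[of w]] by (simp add: avg)
  then show ?thesis
    using assms df unfolding kkt_iff_lower_bound by blast
qed

text \<open>Stationarity in \<open>p\<close> balances the two disc forces. By complementarity a disc
  is active or its multiplier is zero, so in both cases the force magnitude is \<open>2 * r\<close>
  times the multiplier, and balance makes the two multipliers equal. All forces are then expressed
  through \<open>p - y1\<close>.\<close>

lemma kkt_equations:
  assumes "kkt A1 b1 A2 b2 r (c1, \<xi>1, c2, \<xi>2) (p, \<alpha>, y1, y2) (m1, m2, k1, k2)" and r: "r > 0"
  shows "m1 \<bullet> b1 + m2 \<bullet> b2 = 1" "k2 = k1" "k1 *\<^sub>R (p - y2) = - (k1 *\<^sub>R (p - y1))"
    "m1 v* facets A1 \<xi>1 = (2 * k1) *\<^sub>R (p - y1)" "m2 v* facets A2 \<xi>2 = - ((2 * k1) *\<^sub>R (p - y1))"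
    "k1 \<noteq> 0 \<Longrightarrow> norm (p - y1) = r" "k1 \<noteq> 0 \<Longrightarrow> norm (p - y2) = r"
proof -
  have g: "lagrangian_gradient A1 b1 A2 b2 (c1, \<xi>1, c2, \<xi>2) (m1, m2, k1, k2) (p, \<alpha>, y1, y2) = 0"
    and nn: "0 \<le> k1" "0 \<le> k2" and comp: "k1 * disc_residual r p y1 = 0" "k2 * disc_residual r p y2 = 0"
    using assms(1) by (auto simp: kkt_def lagrangian_critical_iff)
  have e: "k = 0 \<or> norm (p - y) = r" if "k * disc_residual r p y = 0" for k y
  proof -
    have "k = 0 \<or> (norm (p - y))\<^sup>2 = r\<^sup>2"
      using that by (simp add: disc_residual_def power2_norm_eq_inner)
    then show ?thesis using r by (metis norm_ge_zero power2_eq_iff_nonneg less_imp_le)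
  qed
  have s: "k1 *\<^sub>R (p - y1) + k2 *\<^sub>R (p - y2) = 0"
    using g by (simp add: zero_prod_def flip: scaleR_scaleR scaleR_add_right)
  then have "norm (k1 *\<^sub>R (p - y1)) = norm (k2 *\<^sub>R (p - y2))"
    by (metis add_eq_0_iff norm_minus_cancel)
  then have kr: "k1 * norm (p - y1) = k2 * norm (p - y2)" using nn by simp
  have "k1 * norm (p - y1) = k1 * r" "k2 * norm (p - y2) = k2 * r" using e[OF comp(1)] e[OF comp(2)] by auto
  then show k: "k2 = k1" using kr r by simp
  show p2: "k1 *\<^sub>R (p - y2) = - (k1 *\<^sub>R (p - y1))" using s k by (simp add: eq_neg_iff_add_eq_0 add.commute)
  show "k1 \<noteq> 0 \<Longrightarrow> norm (p - y1) = r" "k1 \<noteq> 0 \<Longrightarrow> norm (p - y2) = r" using e comp k by auto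
  show "m1 \<bullet> b1 + m2 \<bullet> b2 = 1" "m1 v* facets A1 \<xi>1 = (2 * k1) *\<^sub>R (p - y1)"
    using g by (auto simp: zero_prod_def)
  have "m2 v* facets A2 \<xi>2 = 2 *\<^sub>R (k1 *\<^sub>R (p - y2))" using g k by (simp add: zero_prod_def)
  then show "m2 v* facets A2 \<xi>2 = - ((2 * k1) *\<^sub>R (p - y1))" unfolding p2 by simp
qed

section \<open>Independent normals and closedness of the KKT conditions\<close>

text \<open>For at most two rows, pairwise invertibility is linear independence. A single row is
  covered by its unit norm, since the pairwise condition is vacuous there.\<close>

lemma independent_rows_eq_0:
  fixes A :: "real^2^'m" and v :: "real^'m"
  assumes norm1: "\<And>k. norm (row k A) = 1"
    and inv: "\<And>j k. j \<in> S \<Longrightarrow> k \<in> S \<Longrightarrow> j \<noteq> k \<Longrightarrow> invertible (vector [row j A, row k A] :: real^2^2)"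
    and card: "card S \<le> 2" and supp: "\<And>k. k \<notin> S \<Longrightarrow> v $ k = 0" and vA: "v v* A = 0"
  shows "v = 0"
proof -
  have "v v* A = (\<Sum>k\<in>UNIV. v $ k *\<^sub>R row k A)"
    by (simp add: vec_eq_iff vector_matrix_mult_def row_def)
  also have "\<dots> = (\<Sum>k\<in>S. v $ k *\<^sub>R row k A)"
    using supp by (intro sum.mono_neutral_right) auto
  finally have sum0: "(\<Sum>k\<in>S. v $ k *\<^sub>R row k A) = 0" using vA by simp
  have "v $ k = 0" if k: "k \<in> S" for k
  proof (cases "S = {k}")
    case True
    then show ?thesis using sum0 norm1[of k] by auto
  next
    case False
    then obtain j where j: "j \<in> S" "j \<noteq> k" using k by blast
    have S: "S = {j, k}" using card j k by (intro card_seteq[symmetric]) auto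
    define B where "B = (vector [row j A, row k A] :: real^2^2)"
    have "(vector [v $ j, v $ k] :: real^2) v* B = 0"
      using sum0 j(2) by (simp add: S B_def vec_eq_iff vector_matrix_mult_def sum_2 row_def mult.commute)
    moreover obtain C where "B ** C = mat 1" using inv[OF j(1) k j(2)] by (auto simp: B_def invertible_def)
    ultimately have "(vector [v $ j, v $ k] :: real^2) = 0"
      by (metis vector_matrix_mul_assoc vector_matrix_mul_rid vector_matrix_mult_0)
    then show ?thesis by (metis vector_2(2) zero_index)
  qed
  then show ?thesis using supp by (auto simp: vec_eq_iff)
qed

lemma independent_active_eq_0:
  assumes P: "padded_polytope A b r" and ind: "independent_active A g m"
    and supp: "\<And>k. v $ k \<noteq> 0 \<Longrightarrow> g $ k = 0 \<and> m $ k > 0" and v: "v v* facets A \<xi> = 0"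
  shows "v = 0"
proof (rule independent_rows_eq_0[of A "{k. g $ k = 0 \<and> m $ k > 0}"])
  show "v v* A = 0" using v by (simp add: mult_facets_eq_0)
qed (use P ind supp in \<open>auto simp: padded_polytope_def independent_active_def\<close>)

text \<open>The second conclusion says that the contact force is nonzero: without it, independence
  would make both halfspace multipliers vanish, against
  \<open>m1 \<bullet> b1 + m2 \<bullet> b2 = 1\<close>.\<close>

lemma dual_unique:
  assumes r: "r > 0" and P1: "padded_polytope A1 b1 r" and P2: "padded_polytope A2 b2 r"
    and nd: "nondegenerate A1 b1 A2 b2 r q"
    and k: "kkt A1 b1 A2 b2 r q z \<mu>" and k': "kkt A1 b1 A2 b2 r q z \<mu>'"
  shows "\<mu>' = \<mu>" and "fst (snd (snd \<mu>)) \<noteq> 0"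
proof -
  obtain c1 \<xi>1 c2 \<xi>2 where q: "q = (c1, \<xi>1, c2, \<xi>2)" by (cases q)
  obtain p \<alpha> y1 y2 where z: "z = (p, \<alpha>, y1, y2)" by (cases z)
  obtain m1 m2 k1 k2 where \<mu>: "\<mu> = (m1, m2, k1, k2)" by (cases \<mu>)
  obtain m1' m2' k1' k2' where \<mu>': "\<mu>' = (m1', m2', k1', k2')" by (cases \<mu>')
  let ?g1 = "hs_residual A1 b1 r c1 \<xi>1 \<alpha> y1" and ?g2 = "hs_residual A2 b2 r c2 \<xi>2 \<alpha> y2"
  note eqs = kkt_equations[OF k[unfolded q z \<mu>] r]
  note eqs' = kkt_equations[OF k'[unfolded q z \<mu>'] r]
  have df: "0 \<le> m1" "0 \<le> m2" "0 \<le> m1'" "0 \<le> m2'"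
    and c: "\<And>k. m1 $ k = 0 \<or> ?g1 $ k = 0" "\<And>k. m2 $ k = 0 \<or> ?g2 $ k = 0"
      "\<And>k. m1' $ k = 0 \<or> ?g1 $ k = 0" "\<And>k. m2' $ k = 0 \<or> ?g2 $ k = 0"
    using k k' by (auto simp: kkt_def q z \<mu> \<mu>')
  \<comment> \<open>Non-degeneracy is invoked at the midpoint, so that differences of the two
    multiplier vectors are supported on independent rows.\<close>
  define a1 a2 where "a1 = (1 / 2) *\<^sub>R (m1 + m1')" and "a2 = (1 / 2) *\<^sub>R (m2 + m2')"
  have "kkt A1 b1 A2 b2 r (c1, \<xi>1, c2, \<xi>2) (p, \<alpha>, y1, y2) (a1, a2, (k1 + k1') / 2, (k2 + k2') / 2)"
    using kkt_midpoint[OF k k'] by (simp add: q z \<mu> \<mu>' a1_def a2_def)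
  then have ind: "independent_active A1 ?g1 a1" "independent_active A2 ?g2 a2"
    using nd unfolding nondegenerate_def q by blast+
  have pos: "(m + m') $ k > 0"
    if "0 \<le> m" "0 \<le> m'" "m $ k \<noteq> 0 \<or> m' $ k \<noteq> 0" for m m' :: "real^'i" and k
    using that(3) that(1,2)[unfolded less_eq_vec_def, rule_format, of k] by auto
  have zero1: "v = 0"
    if "\<And>k. v $ k \<noteq> 0 \<Longrightarrow> m1 $ k \<noteq> 0 \<or> m1' $ k \<noteq> 0" "v v* facets A1 \<xi>1 = 0" for v
    by (rule independent_active_eq_0[OF P1 ind(1) _ that(2)])
      (use that(1) pos[OF df(1,3)] c in \<open>fastforce simp: a1_def\<close>)
  have zero2: "v = 0"
    if "\<And>k. v $ k \<noteq> 0 \<Longrightarrow> m2 $ k \<noteq> 0 \<or> m2' $ k \<noteq> 0" "v v* facets A2 \<xi>2 = 0" for v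
    by (rule independent_active_eq_0[OF P2 ind(2) _ that(2)])
      (use that(1) pos[OF df(2,4)] c in \<open>fastforce simp: a2_def\<close>)
  have "k1 \<noteq> 0"
  proof
    assume "k1 = 0"
    then have "m1 = 0" "m2 = 0" using eqs by (auto intro: zero1 zero2)
    then show False using eqs(1) by simp
  qed
  then show "fst (snd (snd \<mu>)) \<noteq> 0" by (simp add: \<mu>)
  \<comment> \<open>The forces of both vectors point along the same \<open>p - y1\<close>, and
    \<open>t\<close> is the ratio of their magnitudes. Subtracting \<open>t\<close> times the first
    vector leaves zero force, hence zero by independence.\<close>
  define t where "t = k1' / k1"
  have k1': "k1' = t * k1" using \<open>k1 \<noteq> 0\<close> by (simp add: t_def)
  have "m1' - t *\<^sub>R m1 = 0"
    by (rule zero1) (auto simp: vector_matrix_mult_diff_distrib scaleR_vector_matrix_assoc eqs eqs' k1')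
  moreover have "m2' - t *\<^sub>R m2 = 0"
    by (rule zero2) (auto simp: vector_matrix_mult_diff_distrib scaleR_vector_matrix_assoc eqs eqs' k1')
  ultimately have m': "m1' = t *\<^sub>R m1" "m2' = t *\<^sub>R m2" by auto
  then have "t * (m1 \<bullet> b1 + m2 \<bullet> b2) = 1" using eqs'(1) by (simp add: distrib_left)
  then have "t = 1" using eqs(1) by simp
  then show "\<mu>' = \<mu>" using m' k1' eqs(2) eqs'(2) by (simp add: \<mu> \<mu>')
qed

section \<open>Continuity in the configuration and closedness of the KKT relation\<close>

lemma continuous_facets_mult:
  fixes f :: "'a::t2_space \<Rightarrow> real" and x :: "'a \<Rightarrow> real^2"
  assumes "continuous_on S f" "continuous_on S x"
  shows "continuous_on S (\<lambda>s. facets A (f s) *v x s)"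
proof -
  have "x v* rotation t = vector [cos t * x $ 1 + sin t * x $ 2, cos t * x $ 2 - sin t * x $ 1]" for x t
    by (simp add: vec_eq_iff forall_2 vector_matrix_mult_def sum_2 rotation_def mult.commute)
  moreover have "continuous_on S (\<lambda>s. vector [u s, v s] :: real^2)"
    if "continuous_on S u" "continuous_on S v" for u v :: "'a \<Rightarrow> real"
  proof -
    have "(vector [u s, v s] :: real^2) = u s *\<^sub>R axis 1 1 + v s *\<^sub>R axis 2 1" for s
      by (simp add: vec_eq_iff forall_2 axis_def)
    then show ?thesis using that by (auto intro!: continuous_intros)
  qed
  ultimately have "continuous_on S (\<lambda>s. x s v* rotation (f s))"
    by (simp add: assms continuous_intros)
  from bounded_linear.continuous_on[OF matrix_vector_mul_bounded_linear this, of A]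
  show ?thesis by (simp add: facets_mult)
qed

lemma continuous_hs_residual [continuous_intros]:
  fixes c y :: "'a::t2_space \<Rightarrow> real^2"
  assumes "continuous_on S c" "continuous_on S f" "continuous_on S \<alpha>" "continuous_on S y"
  shows "continuous_on S (\<lambda>s. hs_residual A b r (c s) (f s) (\<alpha> s) (y s))"
  unfolding hs_residual_facets
  by (intro continuous_intros continuous_facets_mult assms)

lemma closed_Collect_le_vec:
  fixes f g :: "'a::topological_space \<Rightarrow> real^'i"
  assumes "continuous_on UNIV f" "continuous_on UNIV g"
  shows "closed {x. f x \<le> g x}"
  unfolding less_eq_vec_def
  by (intro closed_Collect_all closed_Collect_le continuous_on_component assms)

lemma closed_feasible: "closed {(q, z). feasible A1 b1 A2 b2 r q z}"
proof -
  have "{(q, z). feasible A1 b1 A2 b2 r q z} = {s.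
      hs_residual A1 b1 r (fst (fst s)) (fst (snd (fst s))) (fst (snd (snd s))) (fst (snd (snd (snd s)))) \<le> 0 \<and>
      hs_residual A2 b2 r (fst (snd (snd (fst s)))) (snd (snd (snd (fst s)))) (fst (snd (snd s))) (snd (snd (snd (snd s)))) \<le> 0 \<and>
      disc_residual r (fst (snd s)) (fst (snd (snd (snd s)))) \<le> 0 \<and>
      disc_residual r (fst (snd s)) (snd (snd (snd (snd s)))) \<le> 0}"
    by auto
  then show ?thesis
    by (auto simp: disc_residual_def intro!: closed_Collect_conj closed_Collect_le_vec closed_Collect_le continuous_intros)
qed

lemma continuous_lagrangian: "continuous_on UNIV (\<lambda>(q, \<mu>). lagrangian A1 b1 A2 b2 r q \<mu> z)"
proof -
  obtain p \<alpha> y1 y2 where z: "z = (p, \<alpha>, y1, y2)" by (cases z)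
  have "(\<lambda>(q, \<mu>). lagrangian A1 b1 A2 b2 r q \<mu> z) = (\<lambda>(q, \<mu>). objective z +
     fst \<mu> \<bullet> hs_residual A1 b1 r (fst q) (fst (snd q)) \<alpha> y1 +
     fst (snd \<mu>) \<bullet> hs_residual A2 b2 r (fst (snd (snd q))) (snd (snd (snd q))) \<alpha> y2 +
     fst (snd (snd \<mu>)) * disc_residual r p y1 + snd (snd (snd \<mu>)) * disc_residual r p y2)"
    by (auto simp: z)
  then show ?thesis by (auto simp: split_beta intro!: continuous_intros)
qed

text \<open>In lower bound form the relation is an intersection of closed conditions: feasibility,
  signs, and one inequality per test point \<open>w\<close>, each continuous in configuration,
  primal point and multipliers jointly.\<close>

lemma closed_kkt:
  fixes A1 :: "real^2^'m" and A2 :: "real^2^'n"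
  shows "closed {(q, z, \<mu>). kkt A1 b1 A2 b2 r q z \<mu>}"
proof -
  have eq: "{(q, z, \<mu>). kkt A1 b1 A2 b2 r q z \<mu>} =
      (\<lambda>(q, z, \<mu>). (q, z)) -` {(q, z). feasible A1 b1 A2 b2 r q z} \<inter>
      {s. 0 \<le> fst (snd (snd s)) \<and> 0 \<le> fst (snd (snd (snd s))) \<and>
        0 \<le> fst (snd (snd (snd (snd s)))) \<and> 0 \<le> snd (snd (snd (snd (snd s))))} \<inter>
      (\<Inter>w. {s. fst (snd (fst (snd s))) - 1 \<le> (\<lambda>(q, \<mu>). lagrangian A1 b1 A2 b2 r q \<mu> w) (fst s, snd (snd s))})"
    by (auto simp: kkt_iff_lower_bound)
  have "closed ((\<lambda>(q, z, \<mu>). (q, z)) -` {(q, z). feasible A1 b1 A2 b2 r q z} ::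
      (config \<times> primal \<times> ('m, 'n) dual) set)"
    by (intro closed_vimage closed_feasible) (auto simp: split_beta intro!: continuous_intros)
  moreover have "closed {s :: config \<times> primal \<times> ('m, 'n) dual.
      0 \<le> fst (snd (snd s)) \<and> 0 \<le> fst (snd (snd (snd s))) \<and>
      0 \<le> fst (snd (snd (snd (snd s)))) \<and> 0 \<le> snd (snd (snd (snd (snd s))))}"
    by (intro closed_Collect_conj closed_Collect_le_vec closed_Collect_le continuous_intros)
  moreover have "closed {s. fst (snd (fst (snd s))) - 1 \<le>
      (\<lambda>(q, \<mu>). lagrangian A1 b1 A2 b2 r q \<mu> w) (fst s, snd (snd s))}" for w
    by (intro closed_Collect_le continuous_on_compose2[OF continuous_lagrangian] continuous_intros subset_UNIV)
  ultimately show ?thesis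
    unfolding eq by (intro closed_Int closed_INT ballI)
qed

section \<open>Existence and bounds\<close>

text \<open>Since every entry of \<open>b\<close> exceeds \<open>r\<close>, scaling by
  \<open>2 + D / r\<close> raises it to at least \<open>2 * r + D\<close>. After the padding
  \<open>r\<close> is subtracted, a margin of at least \<open>r\<close> remains over the bound
  \<open>D\<close> on the left-hand side.\<close>

lemma hs_residual_neg:
  assumes P: "padded_polytope A b r" and r: "r > 0" and D: "norm (y - c) \<le> D"
  shows "hs_residual A b r c \<xi> (2 + D / r) y $ k < 0"
proof -
  have b: "r < b $ k" "norm (row k A) = 1" using P by (auto simp: padded_polytope_def)
  have "0 \<le> D" using D norm_ge_zero order_trans by blast
  then have "(2 + D / r) * r \<le> (2 + D / r) * b $ k" using b r by (intro mult_left_mono) auto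
  moreover have "(2 + D / r) * r = 2 * r + D" using r by (simp add: field_simps)
  moreover have "(facets A \<xi> *v (y - c)) $ k \<le> D"
    using norm_row_mult_le[OF b(2), of \<xi> "y - c"] D by linarith
  moreover have "hs_residual A b r c \<xi> (2 + D / r) y $ k = (facets A \<xi> *v (y - c)) $ k - ((2 + D / r) * b $ k - r)"
    by (simp add: hs_residual_facets)
  ultimately show ?thesis using r by linarith
qed

text \<open>With \<open>p\<close>, \<open>y1\<close> and \<open>y2\<close> all at \<open>c1\<close>,
  both discs are slack, and the distance from either centre is at most
  \<open>norm (c1 - c2)\<close>.\<close>

lemma feasible_slater_point:
  assumes "padded_polytope A1 b1 r" "padded_polytope A2 b2 r" "r > 0"
  shows "feasible A1 b1 A2 b2 r (c1, \<xi>1, c2, \<xi>2) (c1, 2 + norm (c1 - c2) / r, c1, c1)"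
  using hs_residual_neg[OF assms(1,3), of c1 c1 "norm (c1 - c2)"]
    hs_residual_neg[OF assms(2,3), of c1 c2 "norm (c1 - c2)"] assms(3)
  by (simp add: less_eq_vec_def less_imp_le disc_residual_def)

lemma optimal_primal_alpha_le:
  assumes "padded_polytope A1 b1 r" "padded_polytope A2 b2 r" "r > 0"
    and "optimal_primal A1 b1 A2 b2 r (c1, \<xi>1, c2, \<xi>2) (p, \<alpha>, y1, y2)"
  shows "\<alpha> \<le> 2 + norm (c1 - c2) / r"
  using assms(4) feasible_slater_point[OF assms(1-3), of c1 \<xi>1 c2 \<xi>2]
  unfolding optimal_primal_def by fastforce

text \<open>Uniformity over all orientations and over bounded centres serves both the existence of
  optima at one configuration and compactness along a convergent sequence of configurations.\<close>

lemma feasible_bounded: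
  assumes P1: "padded_polytope A1 b1 r" and P2: "padded_polytope A2 b2 r" and r: "r > 0"
  shows "\<exists>B. \<forall>c1 \<xi>1 c2 \<xi>2 z. norm c1 \<le> M \<and> norm c2 \<le> M \<and> fst (snd z) \<le> M \<and>
    feasible A1 b1 A2 b2 r (c1, \<xi>1, c2, \<xi>2) z \<longrightarrow> norm z \<le> B"
proof -
  obtain C1 where C1: "\<And>c \<xi> \<alpha> y. hs_residual A1 b1 r c \<xi> \<alpha> y \<le> 0 \<Longrightarrow> \<alpha> \<le> M \<Longrightarrow> 0 < \<alpha> \<and> norm (y - c) \<le> C1"
    using padded_polytope_bounds[OF P1 r, of M] by blast
  obtain C2 where C2: "\<And>c \<xi> \<alpha> y. hs_residual A2 b2 r c \<xi> \<alpha> y \<le> 0 \<Longrightarrow> \<alpha> \<le> M \<Longrightarrow> 0 < \<alpha> \<and> norm (y - c) \<le> C2"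
    using padded_polytope_bounds[OF P2 r, of M] by blast
  have "norm z \<le> (r + C1 + M) + (M + ((C1 + M) + (C2 + M)))"
    if h: "norm c1 \<le> M" "norm c2 \<le> M" "fst (snd z) \<le> M" "feasible A1 b1 A2 b2 r (c1, \<xi>1, c2, \<xi>2) z"
    for c1 \<xi>1 c2 \<xi>2 z
  proof -
    obtain p \<alpha> y1 y2 where z: "z = (p, \<alpha>, y1, y2)" by (cases z)
    have f: "\<alpha> \<le> M" "hs_residual A1 b1 r c1 \<xi>1 \<alpha> y1 \<le> 0" "hs_residual A2 b2 r c2 \<xi>2 \<alpha> y2 \<le> 0"
      "disc_residual r p y1 \<le> 0"
      using h by (auto simp: z)
    have "(norm (p - y1))\<^sup>2 \<le> r\<^sup>2" using f(4) by (simp add: disc_residual_def power2_norm_eq_inner)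
    then have py: "norm (p - y1) \<le> r" by (rule power2_le_imp_le) (use r in simp)
    have y1: "norm y1 \<le> C1 + M" using C1[OF f(2,1)] h(1) norm_triangle_sub[of y1 c1] by linarith
    have y2: "norm y2 \<le> C2 + M" using C2[OF f(3,1)] h(2) norm_triangle_sub[of y2 c2] by linarith
    have p: "norm p \<le> r + C1 + M" using py y1 norm_triangle_sub[of p y1] by linarith
    have \<alpha>: "norm \<alpha> \<le> M" using C1[OF f(2,1)] f(1) by simp
    show ?thesis
      unfolding z using p \<alpha> y1 y2
      by (intro order_trans[OF norm_Pair_le] add_mono order_trans[OF norm_Pair_le])
  qed
  then show ?thesis by blast
qed

text \<open>Cutting off at the scaling of the Slater point leaves a nonempty compact set, on which
  the scaling attains its minimum.\<close>

lemma optimal_primal_exists: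
  assumes P1: "padded_polytope A1 b1 r" and P2: "padded_polytope A2 b2 r" and r: "r > 0"
  shows "\<exists>z. optimal_primal A1 b1 A2 b2 r q z"
proof -
  obtain c1 \<xi>1 c2 \<xi>2 where q: "q = (c1, \<xi>1, c2, \<xi>2)" by (cases q)
  define \<alpha>0 where "\<alpha>0 = 2 + norm (c1 - c2) / r"
  define C where "C = {z. feasible A1 b1 A2 b2 r q z \<and> fst (snd z) \<le> \<alpha>0}"
  define M where "M = max \<alpha>0 (max (norm c1) (norm c2))"
  have M: "norm c1 \<le> M" "norm c2 \<le> M" "\<alpha>0 \<le> M" by (auto simp: M_def)
  obtain B where B: "\<forall>c1 \<xi>1 c2 \<xi>2 z. norm c1 \<le> M \<and> norm c2 \<le> M \<and> fst (snd z) \<le> M \<and>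
      feasible A1 b1 A2 b2 r (c1, \<xi>1, c2, \<xi>2) z \<longrightarrow> norm z \<le> B"
    using feasible_bounded[OF P1 P2 r] by blast
  have "norm z \<le> B" if "z \<in> C" for z
    using that B M order_trans[OF _ M(3)] unfolding C_def q by blast
  then have "bounded C" unfolding bounded_iff by blast
  moreover have "closed C"
  proof -
    have "closed (Pair q -` {(q, z). feasible A1 b1 A2 b2 r q z})"
      by (intro closed_vimage closed_feasible continuous_intros)
    moreover have "closed {z :: primal. fst (snd z) \<le> \<alpha>0}"
      by (intro closed_Collect_le continuous_intros)
    moreover have "C = (Pair q -` {(q, z). feasible A1 b1 A2 b2 r q z}) \<inter> {z. fst (snd z) \<le> \<alpha>0}"
      by (auto simp: C_def)
    ultimately show ?thesis by auto
  qed
  ultimately have "compact C" by (simp add: compact_eq_bounded_closed)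
  moreover have "(c1, \<alpha>0, c1, c1) \<in> C"
    using feasible_slater_point[OF P1 P2 r] by (simp add: C_def \<alpha>0_def q)
  moreover have "continuous_on C (\<lambda>z. fst (snd z))" by (intro continuous_intros)
  ultimately have "\<exists>z\<in>C. \<forall>z'\<in>C. fst (snd z) \<le> fst (snd z')"
    by (intro continuous_attains_inf) blast+
  then obtain z where z: "z \<in> C" "\<And>z'. z' \<in> C \<Longrightarrow> fst (snd z) \<le> fst (snd z')" by blast
  have obj: "objective z = fst (snd z) - 1" for z by (cases z) simp
  \<comment> \<open>Feasible points outside \<open>C\<close> have scaling above
    \<open>\<alpha>0\<close>, which already bounds that of \<open>z\<close>.\<close>
  have "fst (snd z) \<le> fst (snd z')" if "feasible A1 b1 A2 b2 r q z'" for z'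
    using z(2)[of z'] z(1) that by (cases "fst (snd z') \<le> \<alpha>0") (auto simp: C_def)
  then have "optimal_primal A1 b1 A2 b2 r q z" using z(1) by (simp add: optimal_primal_def obj C_def)
  then show ?thesis by blast
qed

section \<open>Convexity of the constraints and existence of multipliers\<close>

lemma hs_residual_affine:
  assumes "u + v = 1"
  shows "hs_residual A b r c \<xi> (u * \<alpha> + v * \<alpha>') (u *\<^sub>R y + v *\<^sub>R y') =
    u *\<^sub>R hs_residual A b r c \<xi> \<alpha> y + v *\<^sub>R hs_residual A b r c \<xi> \<alpha>' y'"
proof -
  have u: "u = 1 - v" using assms by simp
  show ?thesis
    unfolding hs_residual_facets u
    by (simp add: vec_eq_iff matrix_vector_mult_diff_distrib matrix_vector_right_distrib
        matrix_vector_mult_scaleR algebra_simps)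
qed

lemma disc_residual_convex:
  assumes "0 \<le> u" "0 \<le> v" "u + v = 1"
  shows "disc_residual r (u *\<^sub>R p + v *\<^sub>R p') (u *\<^sub>R y + v *\<^sub>R y') \<le>
    u * disc_residual r p y + v * disc_residual r p' y'"
proof -
  define w w' where "w = p - y" and "w' = p' - y'"
  have u: "u = 1 - v" using assms by simp
  \<comment> \<open>The convexity gap of the squared norm is \<open>u * v\<close> times the squared
    distance of the two arguments.\<close>
  have "u * (w \<bullet> w) + v * (w' \<bullet> w') - (u *\<^sub>R w + v *\<^sub>R w') \<bullet> (u *\<^sub>R w + v *\<^sub>R w') = u * v * ((w - w') \<bullet> (w - w'))"
    unfolding u by (simp add: inner_diff_left inner_diff_right inner_add_left inner_add_right inner_commute algebra_simps)
  moreover have "0 \<le> u * v * ((w - w') \<bullet> (w - w'))" using assms by simp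
  moreover have "(u *\<^sub>R p + v *\<^sub>R p') - (u *\<^sub>R y + v *\<^sub>R y') = u *\<^sub>R w + v *\<^sub>R w'"
    by (simp add: w_def w'_def algebra_simps)
  moreover have "u * r\<^sup>2 + v * r\<^sup>2 = r\<^sup>2" using assms by (simp flip: distrib_right)
  ultimately show ?thesis
    by (simp add: disc_residual_def right_diff_distrib flip: w_def w'_def)
qed

text \<open>All constraints are bundled into one map \<open>g\<close> whose values have the shape of
  a multiplier vector. The separation result then yields exactly the lower bound form of the KKT
  conditions.\<close>

lemma optimal_primal_imp_kkt:
  fixes A1 :: "real^2^'m" and A2 :: "real^2^'n"
  assumes P1: "padded_polytope A1 b1 r" and P2: "padded_polytope A2 b2 r" and r: "r > 0"
    and opt: "optimal_primal A1 b1 A2 b2 r q z"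
  shows "\<exists>\<mu>. kkt A1 b1 A2 b2 r q z \<mu>"
proof -
  obtain c1 \<xi>1 c2 \<xi>2 where q: "q = (c1, \<xi>1, c2, \<xi>2)" by (cases q)
  define g :: "primal \<Rightarrow> (real^'m) \<times> (real^'n) \<times> real \<times> real" where
    "g = (\<lambda>(p, \<alpha>, y1, y2). (hs_residual A1 b1 r c1 \<xi>1 \<alpha> y1, hs_residual A2 b2 r c2 \<xi>2 \<alpha> y2,
       disc_residual r p y1, disc_residual r p y2))"
  have feas: "feasible A1 b1 A2 b2 r q z \<longleftrightarrow> g z \<le> 0" for z
    by (cases z) (auto simp: q g_def less_eq_prod_def zero_prod_def)
  have "\<exists>\<mu>\<ge>0. \<forall>x. objective z \<le> objective x + \<mu> \<bullet> g x"
  proof (rule slater_multiplier)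
    show "convex_on UNIV objective"
      unfolding convex_on_def
    proof (intro conjI convex_UNIV ballI allI impI)
      fix x y :: primal and u v :: real
      assume "u + v = 1"
      then have "u * a + v * b - 1 = u * (a - 1) + v * (b - 1)" for a b :: real
        by (simp add: algebra_simps)
      then show "objective (u *\<^sub>R x + v *\<^sub>R y) \<le> u * objective x + v * objective y"
        by (cases x; cases y) simp
    qed
    fix x y :: primal and u v :: real
    assume "0 \<le> u" "0 \<le> v" "u + v = 1"
    then show "g (u *\<^sub>R x + v *\<^sub>R y) \<le> u *\<^sub>R g x + v *\<^sub>R g y"
      by (cases x; cases y) (simp add: g_def less_eq_prod_def hs_residual_affine disc_residual_convex)
  next
    fix i :: "(real^'m) \<times> (real^'n) \<times> real \<times> real"
    assume "i \<in> Basis"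
    then show "g (c1, 2 + norm (c1 - c2) / r, c1, c1) \<bullet> i < 0"
      using hs_residual_neg[OF P1 r, of c1 c1 "norm (c1 - c2)"]
        hs_residual_neg[OF P2 r, of c1 c2 "norm (c1 - c2)"] r
      by (auto simp: g_def Basis_prod_def Basis_vec_def inner_axis disc_residual_def)
  next
    fix x assume "g x \<le> 0"
    then show "objective z \<le> objective x" using opt unfolding optimal_primal_def feas by blast
  qed
  then obtain \<mu> where \<mu>: "0 \<le> \<mu>" "\<And>x. objective z \<le> objective x + \<mu> \<bullet> g x" by blast
  have "objective x + \<mu> \<bullet> g x = lagrangian A1 b1 A2 b2 r q \<mu> x" for x
    by (cases x; cases \<mu>) (simp add: q g_def)
  moreover have "dual_feasible \<mu>" using \<mu>(1) by (cases \<mu>) (simp add: less_eq_prod_def zero_prod_def)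
  ultimately show ?thesis
    using \<mu>(2) opt unfolding kkt_iff_lower_bound optimal_primal_def by metis
qed

section \<open>Uniform bounds on the multipliers\<close>

lemma sum_multipliers_le:
  assumes P: "padded_polytope A b r" and m: "0 \<le> m"
  shows "r * (\<Sum>k\<in>UNIV. m $ k) \<le> m \<bullet> b"
proof -
  have "r * m $ k \<le> m $ k * b $ k" for k
    using P m unfolding padded_polytope_def less_eq_vec_def mult.commute[of r]
    by (intro mult_left_mono) (auto intro: less_imp_le)
  then show ?thesis by (simp add: inner_vec_def sum_distrib_left sum_mono)
qed

lemma norm_le_sum_multipliers:
  fixes m :: "real^'i"
  assumes "0 \<le> m"
  shows "norm m \<le> (\<Sum>k\<in>UNIV. m $ k)"
  using norm_le_l1_cart[of m] assms by (simp add: less_eq_vec_def)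

text \<open>Stationarity in \<alpha> normalises the halfspace multipliers, and \<open>b\<close>
  exceeding \<open>r\<close> turns this into a bound on their sum. The force they can exert through
  unit normals then bounds the disc multiplier. Only \<open>r\<close> enters, so the bound is the
  same at all configurations.\<close>

lemma dual_bounded:
  fixes m1 :: "real^'m" and m2 :: "real^'n"
  assumes P1: "padded_polytope A1 b1 r" and P2: "padded_polytope A2 b2 r" and r: "r > 0"
    and k: "kkt A1 b1 A2 b2 r (c1, \<xi>1, c2, \<xi>2) (p, \<alpha>, y1, y2) (m1, m2, k1, k2)"
  shows "norm (m1, m2, k1, k2) \<le> 1 / r + (1 / r + (1 / r\<^sup>2 + 1 / r\<^sup>2))"
proof -
  have nn: "0 \<le> m1" "0 \<le> m2" "0 \<le> k1" using k by (auto simp: kkt_def)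
  note eqs = kkt_equations[OF k r]
  define s1 s2 where "s1 = (\<Sum>k\<in>UNIV. m1 $ k)" and "s2 = (\<Sum>k\<in>UNIV. m2 $ k)"
  have s: "r * s1 + r * s2 \<le> 1" "norm m1 \<le> s1" "norm m2 \<le> s2"
    using sum_multipliers_le[OF P1 nn(1)] sum_multipliers_le[OF P2 nn(2)] eqs(1)
      norm_le_sum_multipliers[OF nn(1)] norm_le_sum_multipliers[OF nn(2)]
    by (auto simp: s1_def s2_def)
  then have s0: "0 \<le> s1" "0 \<le> s2" using norm_ge_zero order_trans by blast+
  then have rs: "r * s1 \<le> 1" "r * s2 \<le> 1"
    using s(1) mult_nonneg_nonneg[of r s1] mult_nonneg_nonneg[of r s2] r by linarith+
  then have "s1 \<le> 1 / r" "s2 \<le> 1 / r" using r by (simp_all add: pos_le_divide_eq mult.commute)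
  then have m: "norm m1 \<le> 1 / r" "norm m2 \<le> 1 / r" using s by linarith+
  have "k1 * r\<^sup>2 \<le> 1"
  proof (cases "k1 = 0")
    case False
    \<comment> \<open>Pairing the contact force with \<open>p - y1\<close>, of length
      \<open>r\<close>, isolates \<open>k1\<close> on one side and leaves unit normals on the
      other.\<close>
    have "(2 * k1) * r\<^sup>2 = (2 * k1) * ((p - y1) \<bullet> (p - y1))"
      using eqs(6)[OF False] by (simp add: power2_norm_eq_inner[symmetric])
    also have "\<dots> = (m1 v* facets A1 \<xi>1) \<bullet> (p - y1)" by (simp add: eqs(4))
    also have "\<dots> = (\<Sum>k\<in>UNIV. m1 $ k * (facets A1 \<xi>1 *v (p - y1)) $ k)"
      unfolding dot_lmul_matrix by (simp only: inner_vec_def inner_real_def)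
    also have "\<dots> \<le> (\<Sum>k\<in>UNIV. m1 $ k * r)"
    proof (intro sum_mono mult_left_mono)
      fix k
      show "(facets A1 \<xi>1 *v (p - y1)) $ k \<le> r"
        using norm_row_mult_le[of k A1 \<xi>1 "p - y1"] P1 eqs(6)[OF False] by (auto simp: padded_polytope_def)
      show "0 \<le> m1 $ k" using nn(1) by (simp add: less_eq_vec_def)
    qed
    also have "\<dots> = r * s1" by (simp add: s1_def sum_distrib_left mult.commute)
    finally show ?thesis using rs(1) mult_nonneg_nonneg[OF nn(3), of "r\<^sup>2"] by simp
  qed simp
  then have "norm k1 \<le> 1 / r\<^sup>2" using r nn(3) by (simp add: field_simps)
  then show ?thesis
    using m eqs(2) by (intro order_trans[OF norm_Pair_le] add_mono order_trans[OF norm_Pair_le]) auto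
qed

section \<open>Contact points in the frontiers and primal uniqueness\<close>

lemma supporting_point_in_frontier:
  fixes p f :: "'a::euclidean_space"
  assumes p: "p \<in> S" and f: "f \<noteq> 0" and max: "\<And>x. x \<in> S \<Longrightarrow> f \<bullet> x \<le> f \<bullet> p"
  shows "p \<in> frontier S"
proof -
  have "p \<notin> interior S"
  proof
    assume "p \<in> interior S"
    then obtain e where e: "e > 0" "cball p e \<subseteq> S" by (auto simp: mem_interior_cball)
    \<comment> \<open>A step of length \<open>e\<close> along \<open>f\<close> stays in the ball but
      increases the functional.\<close>
    have "p + (e / norm f) *\<^sub>R f \<in> S" using e f by (intro subsetD[OF e(2)]) (simp add: dist_norm)
    from max[OF this] have "(e / norm f) * (f \<bullet> f) \<le> 0" by (simp add: inner_add_right)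
    moreover have "0 < (e / norm f) * (f \<bullet> f)" using e(1) f by simp
    ultimately show False by linarith
  qed
  then show ?thesis using p closure_subset by (auto simp: frontier_def)
qed

text \<open>The padded body is the Minkowski sum of a polytope and a disc. The functional
  \<open>p - y\<close> is maximal over the polytope at \<open>y\<close>, because it is a positive
  multiple of a combination of active normals, and over the disc at \<open>p - y\<close>. Hence it
  is maximal over the sum at \<open>p\<close>.\<close>

lemma in_frontier_scaled_padded:
  assumes y: "hs_residual A b r c \<xi> \<alpha> y \<le> 0" and m: "0 \<le> m"
    and comp: "\<And>k. m $ k * hs_residual A b r c \<xi> \<alpha> y $ k = 0"
    and force: "m v* facets A \<xi> = t *\<^sub>R (p - y)" and t: "t > 0" and r: "r > 0" "norm (p - y) = r"
  shows "p \<in> frontier (scaled_padded A b r c \<xi> \<alpha>)"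
proof (rule supporting_point_in_frontier)
  show "p \<in> scaled_padded A b r c \<xi> \<alpha>" using y r(2) by (auto simp: scaled_padded_def)
  show "p - y \<noteq> 0" using r by auto
  fix x assume "x \<in> scaled_padded A b r c \<xi> \<alpha>"
  then obtain y' where y': "hs_residual A b r c \<xi> \<alpha> y' \<le> 0" "norm (x - y') \<le> r"
    by (auto simp: scaled_padded_def)
  have "m \<bullet> hs_residual A b r c \<xi> \<alpha> y = 0" using comp unfolding inner_vec_def inner_real_def by (intro sum.neutral) blast
  then have "m \<bullet> hs_residual A b r c \<xi> \<alpha> y' \<le> m \<bullet> hs_residual A b r c \<xi> \<alpha> y"
    using inner_nonneg_nonpos_vec(1)[OF m y'(1)] by simp
  then have "t * ((p - y) \<bullet> (y' - c)) \<le> t * ((p - y) \<bullet> (y - c))"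
    unfolding inner_hs_residual force by simp
  then have "(p - y) \<bullet> y' \<le> (p - y) \<bullet> y" using t by (simp add: inner_diff_right)
  moreover have "(p - y) \<bullet> (x - y') \<le> r * r"
    using order_trans[OF norm_cauchy_schwarz mult_mono[OF _ y'(2), of _ r]] r by auto
  moreover have "(p - y) \<bullet> (p - y) = r * r"
    using r(2) by (simp add: power2_norm_eq_inner[symmetric] power2_eq_square)
  ultimately show "(p - y) \<bullet> x \<le> (p - y) \<bullet> p"
    by (simp add: inner_diff_right)
qed

lemma min_value_eq:
  assumes "optimal_primal A1 b1 A2 b2 r q z"
  shows "min_value A1 b1 A2 b2 r q = objective z"
  unfolding min_value_def
  by (rule cInf_eq_minimum) (use assms in \<open>auto simp: optimal_primal_def simp del: split_paired_All\<close>)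

lemma kkt_in_frontiers:
  assumes r: "r > 0" and k: "kkt A1 b1 A2 b2 r (c1, \<xi>1, c2, \<xi>2) (p, \<alpha>, y1, y2) (m1, m2, k1, k2)"
    and k1: "k1 \<noteq> 0"
  shows "p \<in> frontier (scaled_padded A1 b1 r c1 \<xi>1 \<alpha>)" "p \<in> frontier (scaled_padded A2 b2 r c2 \<xi>2 \<alpha>)"
proof -
  note eqs = kkt_equations[OF k r]
  have pos: "2 * k1 > 0" using k k1 by (auto simp: kkt_def)
  \<comment> \<open>The force on the second body, opposite to \<open>p - y1\<close>, is rewritten as
    a positive multiple of its own \<open>p - y2\<close>.\<close>
  have "m2 v* facets A2 \<xi>2 = 2 *\<^sub>R (k1 *\<^sub>R (p - y2))" unfolding eqs(3) eqs(5) by simp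
  then have f2: "m2 v* facets A2 \<xi>2 = (2 * k1) *\<^sub>R (p - y2)" by simp
  show "p \<in> frontier (scaled_padded A1 b1 r c1 \<xi>1 \<alpha>)"
    by (rule in_frontier_scaled_padded[OF _ _ _ eqs(4) pos r eqs(6)[OF k1]]) (use k in \<open>auto simp: kkt_def\<close>)
  show "p \<in> frontier (scaled_padded A2 b2 r c2 \<xi>2 \<alpha>)"
    by (rule in_frontier_scaled_padded[OF _ _ _ f2 pos r eqs(7)[OF k1]]) (use k in \<open>auto simp: kkt_def\<close>)
qed

lemma primal_unique:
  assumes r: "r > 0" and k: "kkt A1 b1 A2 b2 r q z \<mu>" and k': "kkt A1 b1 A2 b2 r q z' \<mu>"
    and k1: "fst (snd (snd \<mu>)) \<noteq> 0" and np: "\<not> patch_contact A1 b1 A2 b2 r q"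
  shows "z' = z"
proof -
  obtain c1 \<xi>1 c2 \<xi>2 where q: "q = (c1, \<xi>1, c2, \<xi>2)" by (cases q)
  obtain p \<alpha> y1 y2 where z: "z = (p, \<alpha>, y1, y2)" by (cases z)
  obtain p' \<alpha>' y1' y2' where z': "z' = (p', \<alpha>', y1', y2')" by (cases z')
  obtain m1 m2 k1 k2 where \<mu>: "\<mu> = (m1, m2, k1, k2)" by (cases \<mu>)
  have "k1 \<noteq> 0" using k1 by (simp add: \<mu>)
  note K = k[unfolded q z \<mu>] and K' = k'[unfolded q z' \<mu>]
  note mv = min_value_eq[OF kkt_imp_optimal_primal[OF k]] min_value_eq[OF kkt_imp_optimal_primal[OF k']]
  have \<alpha>: "min_value A1 b1 A2 b2 r (c1, \<xi>1, c2, \<xi>2) + 1 = \<alpha>" "\<alpha>' = \<alpha>"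
    using mv by (auto simp: q z z')
  note fr = kkt_in_frontiers[OF r K \<open>k1 \<noteq> 0\<close>] kkt_in_frontiers[OF r K' \<open>k1 \<noteq> 0\<close>]
  have p: "p' = p"
  proof (rule ccontr)
    assume "p' \<noteq> p"
    then have "patch_contact A1 b1 A2 b2 r q"
      unfolding patch_contact_def q Let_def prod.case \<alpha> using fr[unfolded \<alpha>] by blast
    then show False using np by simp
  qed
  \<comment> \<open>The halfspace force depends only on configuration and multipliers, so it is
    common to both points. Cancelling \<open>k1\<close> recovers \<open>y1\<close> and
    \<open>y2\<close> from \<open>p\<close>.\<close>
  have "k1 *\<^sub>R (p' - y1') = k1 *\<^sub>R (p - y1)"
    using kkt_equations(4)[OF K r] kkt_equations(4)[OF K' r] by (simp flip: scaleR_scaleR)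
  moreover from this have "k1 *\<^sub>R (p' - y2') = k1 *\<^sub>R (p - y2)"
    using kkt_equations(3)[OF K r] kkt_equations(3)[OF K' r] by simp
  ultimately show ?thesis using \<open>k1 \<noteq> 0\<close> p \<alpha> by (simp add: z z')
qed

text \<open>One good subsequence per convergent sequence suffices: at a discontinuity there is a
  sequence whose values, and those of all its subsequences, stay at least \<open>e\<close> away from
  \<open>f x\<close>.\<close>

lemma continuous_on_if_subseq_limits:
  fixes f :: "'a::metric_space \<Rightarrow> 'b::metric_space"
  assumes "\<And>X x. (\<And>n. X n \<in> S) \<Longrightarrow> x \<in> S \<Longrightarrow> X \<longlonglongrightarrow> x \<Longrightarrow>
    \<exists>s. strict_mono (s :: nat \<Rightarrow> nat) \<and> (\<lambda>n. f (X (s n))) \<longlonglongrightarrow> f x"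
  shows "continuous_on S f"
  unfolding continuous_on_iff
proof (intro ballI allI impI, rule ccontr)
  fix x and e :: real
  assume x: "x \<in> S" and e: "e > 0" and "\<not> (\<exists>d>0. \<forall>x'\<in>S. dist x' x < d \<longrightarrow> dist (f x') (f x) < e)"
  then have "\<exists>x'\<in>S. dist x' x < inverse (real (Suc n)) \<and> e \<le> dist (f x') (f x)" for n
    by (metis inverse_positive_iff_positive not_le of_nat_0_less_iff zero_less_Suc)
  then obtain X where X: "\<And>n. X n \<in> S" "\<And>n. dist (X n) x < inverse (real (Suc n))" "\<And>n. e \<le> dist (f (X n)) (f x)"
    by metis
  have "(\<lambda>n. dist (X n) x) \<longlonglongrightarrow> 0"
    by (rule tendsto_sandwich[OF _ _ tendsto_const LIMSEQ_inverse_real_of_nat])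
      (use X(2) less_imp_le in \<open>auto intro!: always_eventually\<close>)
  then have "X \<longlonglongrightarrow> x" by (rule tendsto_dist_iff[THEN iffD2])
  then obtain s where "(\<lambda>n. f (X (s n))) \<longlonglongrightarrow> f x" using assms X(1) x by blast
  then have "\<forall>\<^sub>F n in sequentially. dist (f (X (s n))) (f x) < e" using e by (simp add: tendsto_iff)
  then obtain n where "dist (f (X (s n))) (f x) < e" by (auto simp: eventually_sequentially)
  then show False using X(3)[of "s n"] by simp
qed

section \<open>Uniqueness and continuity\<close>

lemma optimal_dual_ex1:
  assumes r: "r > 0" and P1: "padded_polytope A1 b1 r" and P2: "padded_polytope A2 b2 r"
    and nd: "nondegenerate A1 b1 A2 b2 r q"
  shows "\<exists>!\<mu>. optimal_dual A1 b1 A2 b2 r q \<mu>"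
proof -
  obtain z \<mu> where k: "kkt A1 b1 A2 b2 r q z \<mu>"
    using optimal_primal_exists[OF P1 P2 r] optimal_primal_imp_kkt[OF P1 P2 r] by blast
  show ?thesis
  proof (rule ex1I)
    show "optimal_dual A1 b1 A2 b2 r q \<mu>" using k by (auto simp: optimal_dual_def simp del: split_paired_Ex)
    fix \<mu>' assume "optimal_dual A1 b1 A2 b2 r q \<mu>'"
    then obtain z' where "kkt A1 b1 A2 b2 r q z' \<mu>'" unfolding optimal_dual_def by blast
    \<comment> \<open>The two multiplier vectors may come with different primal points; both are
      moved to \<open>z\<close> before being compared.\<close>
    then have "kkt A1 b1 A2 b2 r q z \<mu>'" using kkt_exchange kkt_imp_optimal_primal k by blast
    then show "\<mu>' = \<mu>" by (rule dual_unique(1)[OF r P1 P2 nd k])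
  qed
qed

lemma kkt_bounded:
  assumes r: "r > 0" and P1: "padded_polytope A1 b1 r" and P2: "padded_polytope A2 b2 r" and Q: "bounded Q"
  shows "bounded {(z, \<mu>). \<exists>q\<in>Q. kkt A1 b1 A2 b2 r q z \<mu>}"
proof -
  obtain N where N: "\<And>q. q \<in> Q \<Longrightarrow> norm q \<le> N" using Q by (auto simp: bounded_iff)
  \<comment> \<open>One constant dominates both the norms of the centres and the Slater scaling, as
    the centres are at most \<open>N + N\<close> apart.\<close>
  define M where "M = max N (2 + (N + N) / r)"
  obtain B where B: "\<forall>c1 \<xi>1 c2 \<xi>2 z. norm c1 \<le> M \<and> norm c2 \<le> M \<and> fst (snd z) \<le> M \<and>
      feasible A1 b1 A2 b2 r (c1, \<xi>1, c2, \<xi>2) z \<longrightarrow> norm z \<le> B"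
    using feasible_bounded[OF P1 P2 r] by blast
  have "norm (z, \<mu>) \<le> B + (1 / r + (1 / r + (1 / r\<^sup>2 + 1 / r\<^sup>2)))"
    if k: "q \<in> Q" "kkt A1 b1 A2 b2 r q z \<mu>" for q z \<mu>
  proof -
    obtain c1 \<xi>1 c2 \<xi>2 where q: "q = (c1, \<xi>1, c2, \<xi>2)" by (cases q)
    obtain p \<alpha> y1 y2 where z: "z = (p, \<alpha>, y1, y2)" by (cases z)
    obtain m1 m2 k1 k2 where \<mu>: "\<mu> = (m1, m2, k1, k2)" by (cases \<mu>)
    have c: "norm c1 \<le> N" "norm c2 \<le> N"
      using N[OF k(1)] norm_fst_le[of c1] norm_snd_le[of "(\<xi>1, c2, \<xi>2)" c1]
        norm_snd_le[of "(c2, \<xi>2)" \<xi>1] norm_fst_le[of c2 \<xi>2]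
      unfolding q by (meson order_trans)+
    then have "norm (c1 - c2) \<le> N + N" using norm_triangle_ineq4[of c1 c2] by linarith
    then have "2 + norm (c1 - c2) / r \<le> M" using r by (simp add: M_def le_max_iff_disj divide_right_mono)
    then have "\<alpha> \<le> M"
      using optimal_primal_alpha_le[OF P1 P2 r] kkt_imp_optimal_primal[OF k(2)] order_trans unfolding q z by blast
    moreover have "norm c1 \<le> M" "norm c2 \<le> M" using c by (auto simp: M_def)
    moreover have "feasible A1 b1 A2 b2 r q z" using k(2) by (simp add: kkt_def)
    ultimately have "norm z \<le> B" using B[rule_format, of c1 c2 z \<xi>1 \<xi>2] unfolding q z by simp
    then show ?thesis
      using dual_bounded[OF P1 P2 r k(2)[unfolded q z \<mu>]] norm_Pair_le[of z \<mu>]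
      unfolding \<mu> by linarith
  qed
  then show ?thesis unfolding bounded_iff by blast
qed

text \<open>A closed relation with bounded values that is single-valued in \<mu> is continuous in
  \<mu>. Primal points are carried along as witnesses: only a subsequence of them has to converge,
  and their limit need not be the only optimal point.\<close>

lemma continuous_on_optimal_dual:
  fixes A1 :: "real^2^'m" and A2 :: "real^2^'n"
  assumes r: "r > 0" and P1: "padded_polytope A1 b1 r" and P2: "padded_polytope A2 b2 r"
    and nd: "\<And>q. q \<in> Q \<Longrightarrow> nondegenerate A1 b1 A2 b2 r q"
  shows "continuous_on Q (\<lambda>q. THE \<mu>. optimal_dual A1 b1 A2 b2 r q \<mu>)"
proof (rule continuous_on_if_subseq_limits)
  fix X x assume X: "\<And>n::nat. X n \<in> Q" and x: "x \<in> Q" and lim: "X \<longlonglongrightarrow> x"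
  define f where "f q = (THE \<mu>. optimal_dual A1 b1 A2 b2 r q \<mu>)" for q
  have f: "optimal_dual A1 b1 A2 b2 r q (f q)" if "q \<in> Q" for q
    unfolding f_def by (rule theI'[OF optimal_dual_ex1[OF r P1 P2 nd[OF that]]])
  then have "\<exists>z. kkt A1 b1 A2 b2 r (X n) z (f (X n))" for n
    using X unfolding optimal_dual_def by blast
  then obtain z where z: "\<And>n. kkt A1 b1 A2 b2 r (X n) (z n) (f (X n))" by metis
  have "bounded (range X)" using lim by (rule convergent_imp_bounded)
  from kkt_bounded[OF r P1 P2 this] have "bounded (range (\<lambda>n. (z n, f (X n))))"
    by (rule bounded_subset) (use z in blast)
  then obtain l s where s: "strict_mono s" and l: "((\<lambda>n. (z n, f (X n))) \<circ> s) \<longlonglongrightarrow> l"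
    using bounded_imp_convergent_subsequence by blast
  have l1: "(\<lambda>n. (z (s n), f (X (s n)))) \<longlonglongrightarrow> l" using l by (simp add: o_def)
  have l2: "(\<lambda>n. (X (s n), z (s n), f (X (s n)))) \<longlonglongrightarrow> (x, l)"
    using LIMSEQ_subseq_LIMSEQ[OF lim s] l1 by (intro tendsto_Pair) (simp_all add: o_def)
  have "(x, l) \<in> {(q, z, \<mu>). kkt A1 b1 A2 b2 r q z \<mu>}"
    by (rule closed_sequentially[OF closed_kkt _ l2]) (simp add: z)
  then have "kkt A1 b1 A2 b2 r x (fst l) (snd l)" by (simp add: split_beta)
  then have "optimal_dual A1 b1 A2 b2 r x (snd l)"
    unfolding optimal_dual_def by blast
  \<comment> \<open>The limit is optimal at \<open>x\<close>, and uniqueness there identifies it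
    with the value of \<open>f\<close>.\<close>
  then have "f x = snd l"
    using optimal_dual_ex1[OF r P1 P2 nd[OF x]] f[OF x] by blast
  then have "(\<lambda>n. f (X (s n))) \<longlonglongrightarrow> f x" using tendsto_snd[OF l1] by simp
  then show "\<exists>s. strict_mono s \<and> (\<lambda>n. THE \<mu>. optimal_dual A1 b1 A2 b2 r (X (s n)) \<mu>) \<longlonglongrightarrow>
      (THE \<mu>. optimal_dual A1 b1 A2 b2 r x \<mu>)"
    using s unfolding f_def by blast
qed

lemma optimal_primal_ex1:
  assumes r: "r > 0" and P1: "padded_polytope A1 b1 r" and P2: "padded_polytope A2 b2 r"
    and nd: "nondegenerate A1 b1 A2 b2 r q" and np: "\<not> patch_contact A1 b1 A2 b2 r q"
  shows "\<exists>!z. optimal_primal A1 b1 A2 b2 r q z"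
proof -
  obtain z where z: "optimal_primal A1 b1 A2 b2 r q z" using optimal_primal_exists[OF P1 P2 r] by blast
  obtain \<mu> where k: "kkt A1 b1 A2 b2 r q z \<mu>" using optimal_primal_imp_kkt[OF P1 P2 r z] by blast
  show ?thesis
  proof (rule ex1I[of _ z])
    fix z' assume "optimal_primal A1 b1 A2 b2 r q z'"
    \<comment> \<open>By exchange \<open>z'\<close> shares the multipliers of \<open>z\<close>.
      Comparing \<mu> with itself in \<open>dual_unique\<close> supplies the nonzero contact
      force.\<close>
    then show "z' = z"
      using primal_unique[OF r k _ dual_unique(2)[OF r P1 P2 nd k k] np] kkt_exchange[OF k] by blast
  qed (rule z)
qed

theorem proposition1:
  fixes A1 :: "real^2^'m" and b1 :: "real^'m"
    and A2 :: "real^2^'n" and b2 :: "real^'n"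
    and r :: real and Q :: "config set"
  assumes "r > 0"
    and "padded_polytope A1 b1 r"
    and "padded_polytope A2 b2 r"
    and "Q = {(c1, \<xi>1, c2, \<xi>2). c1 \<noteq> c2 \<and> nondegenerate A1 b1 A2 b2 r (c1, \<xi>1, c2, \<xi>2)}"
  shows "(\<forall>q\<in>Q. \<exists>!\<mu>. optimal_dual A1 b1 A2 b2 r q \<mu>) \<and>
         continuous_on Q (\<lambda>q. THE \<mu>. optimal_dual A1 b1 A2 b2 r q \<mu>) \<and>
         (\<forall>q\<in>Q. \<not> patch_contact A1 b1 A2 b2 r q \<longrightarrow> (\<exists>!z. optimal_primal A1 b1 A2 b2 r q z))"
proof -
  have nd: "nondegenerate A1 b1 A2 b2 r q" if "q \<in> Q" for q
    using that unfolding assms(4) by (cases q) simp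
  show ?thesis
    by (intro conjI ballI impI optimal_dual_ex1[OF assms(1-3)] continuous_on_optimal_dual[OF assms(1-3)]
        optimal_primal_ex1[OF assms(1-3)] nd)
qed

end
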